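(* Let $K\ge 1$ and consider the binary-symmetric parallel-relay (BSPR) network with $K$ relays, cross-over probabilities $p_{s,i},p_{i,d}\in[0,\tfrac12]$, $i=1,\dots,K$, and capacity $C$. In the following, mutual informations are computed with $V_i$ the output of the source-to-relay-$i$ channel with input $U$, and $Y_i$ the output of the relay-$i$-to-destination channel with input $X_i$; maxima are over distributions on $\{0,1\}$ of the inputs. 1. If $K=1$, then $$C=\max_{p(u)p(x_1)}\min\{I(U;V_1),\,I(X_1;Y_1)\}.$$ 2. If $K>1$ and $$\sum_{j=1}^K\max_{p(x_j)}I(X_j;Y_j)\le \max_{p(u)}I(U;V_i)\quad\text{for all } i\in\{1,\dots,K\},$$ then $$C=\sum_{i=1}^K\max_{p(x_i)}I(X_i;Y_i).$$
   Context: **The BSPR network.** There is one source, $K$ relays $1,\dots,K$, and one destination. All channel inputs, outputs and noises are binary, and $\oplus$ is addition modulo 2. At each time $t=1,2,\dots$ the source transmits $U[t]\in\{0,1\}$ and relay $i$ receives $V_i[t]=U[t]\oplus Z_i[t]$ with $\Pr\{Z_i[t]=1\}=p_{s,i}$; relay $i$ transmits $X_i[t]\in\{0,1\}$ and the destination receives, on a separate link for each $i$, $Y_i[t]=X_i[t]\oplus E_i[t]$ with $\Pr\{E_i[t]=1\}=p_{i,d}$. Here $0\le p_{s,i},p_{i,d}\le \tfrac12$. All the noises $Z_i[t],E_i[t]$ (over all $i,t$) are independent of each other and of the message. Thus the channel from $U$ to $V_i$ has $p(v_i|u)=1-p_{s,i}$ if $v_i=u$ and $p_{s,i}$ otherwise,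 and the channel from $X_i$ to $Y_i$ has $p(y_i|x_i)=1-p_{i,d}$ if $y_i=x_i$ and $p_{i,d}$ otherwise. **Codes, achievable rates, capacity.** A code of rate $R\ge 0$ and length $n$ has a message $W$ uniform on $\{0,1,\dots,\lceil 2^{nR}\rceil-1\}$, a source encoder giving $(U[1],\dots,U[n])$ as a function of $W$, for each relay $i$ and time $t\le n$ a function giving $X_i[t]$ from $(V_i[1],\dots,V_i[t-1])$, and a decoder giving $\hat W$ from $(Y_i[t])_{1\le i\le K,\,1\le t\le n}$. Its error probability is $P_e=\Pr\{\hat W\ne W\}$. A rate $R$ is achievable if for every $\epsilon>0$ and all sufficiently large $n$ there is a code of rate $R$ and length $n$ with $P_e<\epsilon$. The capacity $C$ is the supremum of all achievable rates. $I(\cdot\,;\cdot)$ is mutual information with logarithms to base 2; rates are in bits per channel use. *)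

theory Defs
  imports "HOL-Probability.Probability"
begin

text \<open>
  Binary symbols are of type \<^typ>\<open>bool\<close> (\<^term>\<open>True\<close> is 1), so that addition modulo 2
  is inequality.
\<close>

definition bsc :: "real \<Rightarrow> bool \<Rightarrow> bool pmf" where
  "bsc p x = map_pmf (\<lambda>z. x \<noteq> z) (bernoulli_pmf p)"

lemma pmf_bsc:
  assumes "0 \<le> p" "p \<le> 1"
  shows "pmf (bsc p x) y = (if y = x then 1 - p else p)"
proof -
  have "inj (\<lambda>z. x \<noteq> z)" by (auto simp: inj_on_def)
  then have "pmf (bsc p x) (x \<noteq> (x \<noteq> y)) = pmf (bernoulli_pmf p) (x \<noteq> y)"
    unfolding bsc_def by (rule pmf_map_inj')
  moreover have "(x \<noteq> (x \<noteq> y)) = y" by auto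
  ultimately show ?thesis using assms by (cases x; cases y) auto
qed

definition bsc_joint :: "real \<Rightarrow> bool pmf \<Rightarrow> (bool \<times> bool) pmf" where
  "bsc_joint p q = bind_pmf q (\<lambda>x. map_pmf (Pair x) (bsc p x))"

text \<open>Mutual information, in bits, between the input (distributed as \<open>q\<close>) and the output.\<close>

definition bsc_info :: "real \<Rightarrow> bool pmf \<Rightarrow> real" where
  "bsc_info p q = prob_space.mutual_information (measure_pmf (bsc_joint p q)) 2
     (count_space UNIV) (count_space UNIV) fst snd"

text \<open>The maximum (not merely the supremum) of a function; unspecified if it is not attained.\<close>

definition max_over :: "('a \<Rightarrow> real) \<Rightarrow> real" where
  "max_over f = (GREATEST c. c \<in> range f)"

lemma max_over_eqI: "(\<And>x. f x \<le> f a) \<Longrightarrow> max_over f = f a"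
  unfolding max_over_def by (rule Greatest_equality) auto

text \<open>
  Relays are numbered \<open>1..K\<close> and time slots \<open>1..n\<close>; messages are \<open>0..<M\<close>.
  \<open>src c w t\<close> is \<open>U[t]\<close>. \<open>rel c i [V\<^sub>i[1], \<dots>, V\<^sub>i[t-1]]\<close> is \<open>X\<^sub>i[t]\<close>: a relay function takes the
  list of past received symbols, whose length determines \<open>t\<close>, so a single function per relay
  amounts to one for each time slot. The decoder takes the list over relays of the length-\<open>n\<close>
  lists of received symbols.
\<close>

record bspr_code =
  src :: "nat \<Rightarrow> nat \<Rightarrow> bool"
  rel :: "nat \<Rightarrow> bool list \<Rightarrow> bool"
  dec :: "bool list list \<Rightarrow> nat"

text \<open>Below, \<open>w\<close> is the message, \<open>z (i, t)\<close> is \<open>Z\<^sub>i[t]\<close> and \<open>e (i, t)\<close> is \<open>E\<^sub>i[t]\<close>.\<close>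

definition relay_in :: "bspr_code \<Rightarrow> nat \<Rightarrow> (nat \<times> nat \<Rightarrow> bool) \<Rightarrow> nat \<Rightarrow> nat \<Rightarrow> bool" where
  "relay_in c w z i t \<longleftrightarrow> src c w t \<noteq> z (i, t)"

definition relay_out :: "bspr_code \<Rightarrow> nat \<Rightarrow> (nat \<times> nat \<Rightarrow> bool) \<Rightarrow> nat \<Rightarrow> nat \<Rightarrow> bool" where
  "relay_out c w z i t = rel c i (map (relay_in c w z i) [1..<t])"

definition dest_in ::
    "bspr_code \<Rightarrow> nat \<Rightarrow> (nat \<times> nat \<Rightarrow> bool) \<Rightarrow> (nat \<times> nat \<Rightarrow> bool) \<Rightarrow> nat \<Rightarrow> nat \<Rightarrow> bool" where
  "dest_in c w z e i t \<longleftrightarrow> relay_out c w z i t \<noteq> e (i, t)"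

definition decoded ::
    "nat \<Rightarrow> nat \<Rightarrow> bspr_code \<Rightarrow> nat \<Rightarrow> (nat \<times> nat \<Rightarrow> bool) \<Rightarrow> (nat \<times> nat \<Rightarrow> bool) \<Rightarrow> nat" where
  "decoded K n c w z e = dec c (map (\<lambda>i. map (dest_in c w z e i) [1..<Suc n]) [1..<Suc K])"

definition noise_pmf :: "nat \<Rightarrow> nat \<Rightarrow> (nat \<Rightarrow> real) \<Rightarrow> (nat \<times> nat \<Rightarrow> bool) pmf" where
  "noise_pmf K n p = Pi_pmf ({1..K} \<times> {1..n}) False (\<lambda>(i, t). bernoulli_pmf (p i))"

definition error_prob ::
    "nat \<Rightarrow> (nat \<Rightarrow> real) \<Rightarrow> (nat \<Rightarrow> real) \<Rightarrow> nat \<Rightarrow> nat \<Rightarrow> bspr_code \<Rightarrow> real" where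
  "error_prob K ps pd M n c =
     measure_pmf.prob
       (pair_pmf (pmf_of_set {0..<M}) (pair_pmf (noise_pmf K n ps) (noise_pmf K n pd)))
       {(w, z, e). decoded K n c w z e \<noteq> w}"

definition num_messages :: "nat \<Rightarrow> real \<Rightarrow> nat" where
  "num_messages n R = nat \<lceil>2 powr (real n * R)\<rceil>"

definition achievable :: "nat \<Rightarrow> (nat \<Rightarrow> real) \<Rightarrow> (nat \<Rightarrow> real) \<Rightarrow> real \<Rightarrow> bool" where
  "achievable K ps pd R \<longleftrightarrow>
     0 \<le> R \<and>
     (\<forall>\<epsilon>>0. \<forall>\<^sub>F n in sequentially. \<exists>c. error_prob K ps pd (num_messages n R) n c < \<epsilon>)"

definition capacity :: "nat \<Rightarrow> (nat \<Rightarrow> real) \<Rightarrow> (nat \<Rightarrow> real) \<Rightarrow> real" where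
  "capacity K ps pd = Sup {R. achievable K ps pd R}"

end

theory Submission
  imports Defs
begin

text \<open>
  All channels add noise modulo 2, so every part of the proof reduces to counting on the cube
  \<open>{0,1}\<^sup>I\<close>. Let \<open>L\<close> be the self-information of the noise vector, a sum of independent bounded
  variables; by Hoeffding it is within \<open>\<delta>|I|\<close> of the entropy up to exponentially small probability.

  Converse: fix all noise except that of one hop. The regions decoded to different messages are
  disjoint after translation by the codewords, and a noise vector with \<open>L \<ge> a\<close> has probability at most
  \<open>2\<^sup>-\<^sup>a\<close>; so the success probability tends to 0 above the capacity of that hop, and no
  data-processing or Fano inequality is needed.

  Achievability: codewords are picked greedily, avoiding the typical-set neighbourhoods of the earlier
  ones, which bounds the error of every single message. Since \<open>L\<close> for the worst relay is
  monotone in the number of noise ones, one typical set, hence one code, serves all relays. Block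
  Markov coding lets every relay decode a block and then forward it jointly with the other relays, as
  one encoder for the parallel channels, during the next block; a union bound over a fixed
  number of blocks concludes.
\<close>

section \<open>Mutual information of the binary symmetric channel\<close>

definition binent :: "real \<Rightarrow> real" where
  "binent p = - (p * log 2 p) - (1 - p) * log 2 (1 - p)"

text \<open>Gibbs' inequality against the fair coin: \<open>ln x \<le> x - 1\<close> is applied to
  the ratios \<open>1 / (2 * p)\<close> and \<open>1 / (2 * (1 - p))\<close>, and the weighted
  right-hand sides cancel.\<close>

lemma binent_le_1:
  assumes "0 \<le> p" "p \<le> 1"
  shows "binent p \<le> 1"
proof (cases "p = 0 \<or> p = 1")
  case True
  then show ?thesis by (auto simp: binent_def)
next
  case False
  with assms have p: "0 < p" "p < 1" by auto
  have "p * ln (1 / (2 * p)) + (1 - p) * ln (1 / (2 * (1 - p)))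
      \<le> p * (1 / (2 * p) - 1) + (1 - p) * (1 / (2 * (1 - p)) - 1)"
    using p by (intro add_mono mult_left_mono ln_le_minus_one) auto
  also have "\<dots> = 0" using p by (simp add: field_simps)
  finally have *: "p * ln (1 / (2 * p)) + (1 - p) * ln (1 / (2 * (1 - p))) \<le> 0" .
  have "- (p * ln p) - (1 - p) * ln (1 - p) \<le> ln 2"
  proof -
    have ln: "ln (1 / (2 * x)) = - ln 2 - ln x" if "x > 0" for x :: real
      using that by (simp add: ln_div ln_mult)
    have "p * (- ln 2 - ln p) + (1 - p) * (- ln 2 - ln (1 - p)) \<le> 0"
      using * p by (simp only: ln diff_gt_0_iff_gt)
    moreover have "p * (- ln 2 - ln p) + (1 - p) * (- ln 2 - ln (1 - p)) =
        - (p * ln p) - (1 - p) * ln (1 - p) - ln 2"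
      by (simp add: left_diff_distrib right_diff_distrib)
    ultimately show ?thesis by linarith
  qed
  then have "(- (p * ln p) - (1 - p) * ln (1 - p)) / ln 2 \<le> 1" by simp
  then show ?thesis unfolding binent_def log_def by (simp add: diff_divide_distrib)
qed

lemma binent_half: "binent (1/2) = 1"
  by (simp add: binent_def log_divide)

lemma pmf_bsc_joint:
  assumes "0 \<le> p" "p \<le> 1"
  shows "pmf (bsc_joint p q) (x, y) = pmf q x * (if y = x then 1 - p else p)"
proof -
  have "pmf (map_pmf (Pair x') (bsc p x')) (x, y) = (if x' = x then pmf (bsc p x) y else 0)" for x'
  proof (cases "x' = x")
    case True
    have "pmf (map_pmf (Pair x) (bsc p x)) (Pair x y) = pmf (bsc p x) y"
      by (rule pmf_map_inj') (auto simp: inj_on_def)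
    with True show ?thesis by simp
  next
    case False
    then show ?thesis by (auto simp: pmf_eq_0_set_pmf)
  qed
  then have "pmf (bsc_joint p q) (x, y) =
      measure_pmf.expectation q (\<lambda>x'. if x' = x then pmf (bsc p x) y else 0)"
    unfolding bsc_joint_def pmf_bind by simp
  also have "\<dots> = pmf q x * pmf (bsc p x) y"
    by (subst integral_measure_pmf[of UNIV]) (cases x; auto simp: UNIV_bool)+
  finally show ?thesis using assms by (simp add: pmf_bsc)
qed

lemma pmf_False_eq: "pmf q False = 1 - pmf q True"
proof -
  have "(\<Sum>x\<in>UNIV. pmf q x) = 1" by (rule sum_pmf_eq_1) auto
  then show ?thesis by (simp add: UNIV_bool)
qed

text \<open>The decomposition \<open>I(X;Y) = H(Y) - H(Y|X)\<close>: \<open>y q\<close> is the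
  probability that the output is \<open>True\<close>, and given either input the output has entropy
  \<open>binent p\<close>.\<close>

lemma bsc_info_eq:
  assumes p: "0 \<le> p" "p \<le> 1"
  defines "y \<equiv> \<lambda>q. pmf q True * (1 - p) + pmf q False * p"
  shows "bsc_info p q = binent (y q) - binent p"
proof -
  let ?M = "bsc_joint p q"
  interpret information_space "measure_pmf ?M" 2
    by unfold_locales simp
  have simple: "simple_function (measure_pmf ?M) f" for f :: "_ \<Rightarrow> 'b::finite"
    by (simp add: simple_function_def)
  have marg: "measure_pmf.prob ?M A = (\<Sum>v\<in>A. pmf ?M v)" for A
    by (rule measure_measure_pmf_finite) simp
  have pos: "0 \<le> pmf q True" "pmf q True \<le> 1" by (auto simp: pmf_le_1)
  have sum1: "pmf q False = 1 - pmf q True"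
    by (rule pmf_False_eq)
  let ?P = "\<lambda>(x::bool, z). pmf q x * (if z = x then 1 - p else p)"
  let ?Y = "\<lambda>z. if z then y q else 1 - y q"
  have y: "0 \<le> y q" "y q \<le> 1"
  proof -
    show "0 \<le> y q" using p pos by (auto simp: y_def sum1)
    have "y q \<le> 1 * (1 - p) + 1 * p"
      unfolding y_def using p by (intro add_mono mult_right_mono) (auto simp: pmf_le_1)
    then show "y q \<le> 1" by simp
  qed
  have A1: "fst -` {x} = {(x::bool, True), (x, False)}" for x
    using UNIV_bool by (auto simp: vimage_fst)
  have A2: "snd -` {x} = {(True, x::bool), (False, x)}" for x
    using UNIV_bool by (auto simp: vimage_snd)
  have X: "simple_distributed (measure_pmf ?M) fst (pmf q)"
    by (rule measure_pmf.simple_distributedI[OF simple]) (auto simp: marg A1 pmf_bsc_joint p algebra_simps)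
  have Y: "simple_distributed (measure_pmf ?M) snd ?Y"
    by (rule measure_pmf.simple_distributedI[OF simple])
      (use y in \<open>auto simp: marg A2 pmf_bsc_joint p y_def sum1 algebra_simps\<close>)
  have XY: "simple_distributed (measure_pmf ?M) (\<lambda>v. (fst v, snd v)) ?P"
    by (rule measure_pmf.simple_distributedI[OF simple])
      (use p in \<open>auto simp: marg pmf_bsc_joint vimage_def\<close>)
  have img: "fst ` (UNIV :: (bool \<times> bool) set) = UNIV" "snd ` (UNIV :: (bool \<times> bool) set) = UNIV"
    by auto
  have info: "bsc_info p q = (\<Sum>(x, z)\<in>(UNIV :: (bool \<times> bool) set).
      ?P (x, z) * log 2 (?P (x, z) / (pmf q x * ?Y z)))"
    using mutual_information_simple_distributed[OF X Y XY]
    by (simp add: bsc_info_def img)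
  have key: "a * d * log 2 (a * d / (a * e)) = a * (d * log 2 d) - a * d * log 2 e"
    if "a > 0" "d > 0" "e > 0" for a d e :: real
    using that by (simp add: log_divide_pos right_diff_distrib)
  have summand: "pmf q x * (if z = x then 1 - p else p)
        * log 2 (pmf q x * (if z = x then 1 - p else p) / (pmf q x * ?Y z)) =
      pmf q x * (if z = x then (1 - p) * log 2 (1 - p) else p * log 2 p)
        - pmf q x * (if z = x then 1 - p else p) * log 2 (?Y z)" (is "?lhs = ?rhs") for x z :: bool
  proof -
    let ?c = "if z = x then 1 - p else p"
    have Yz: "?Y z = pmf q z * (1 - p) + pmf q (\<not> z) * p"
      by (auto simp: y_def sum1 algebra_simps)
    \<comment> \<open>The logarithm of the quotient splits only for positive arguments. Where the
      joint mass vanishes both sides are 0; elsewhere \<open>?Y z\<close> is positive because that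
      mass is one of its summands.\<close>
    show ?thesis
    proof (cases "pmf q x = 0 \<or> ?c = 0")
      case True
      then show ?thesis by (auto split: if_splits)
    next
      case False
      then have "pmf q x > 0" "?c > 0" using p by (auto simp: pmf_pos split: if_splits)
      then have P: "pmf q x * ?c > 0" by simp
      have nonneg: "0 \<le> pmf q z * (1 - p)" "0 \<le> pmf q (\<not> z) * p" using p by auto
      have "?Y z > 0"
        unfolding Yz
      proof (cases "z = x")
        case True
        with P nonneg show "0 < pmf q z * (1 - p) + pmf q (\<not> z) * p" by simp
      next
        case False
        then have "x = (\<not> z)" by auto
        with P nonneg False show "0 < pmf q z * (1 - p) + pmf q (\<not> z) * p" by simp
      qed
      moreover have "(if z = x then (1 - p) * log 2 (1 - p) else p * log 2 p) = ?c * log 2 ?c"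
        by simp
      ultimately show ?thesis
        using key[OF \<open>pmf q x > 0\<close> \<open>?c > 0\<close>, of "?Y z"] by (simp only:)
    qed
  qed
  have "bsc_info p q = (\<Sum>(x, z)\<in>(UNIV :: (bool \<times> bool) set).
      pmf q x * (if z = x then (1 - p) * log 2 (1 - p) else p * log 2 p)
        - pmf q x * (if z = x then 1 - p else p) * log 2 (?Y z))"
    unfolding info by (intro sum.cong refl) (clarify, simp only: prod.case summand)
  also have "\<dots> = binent (y q) - binent p"
    unfolding binent_def UNIV_Times_UNIV[symmetric] sum.cartesian_product[symmetric] UNIV_bool
    by (simp add: y_def sum1 algebra_simps)
  finally show ?thesis .
qed

definition bsc_cap :: "real \<Rightarrow> real" where
  "bsc_cap p = 1 - binent p"

lemma bsc_info_le:
  assumes "0 \<le> p" "p \<le> 1"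
  shows "bsc_info p q \<le> bsc_cap p"
proof -
  have s: "pmf q False = 1 - pmf q True"
    by (rule pmf_False_eq)
  have "pmf q True * (1 - p) + pmf q False * p \<le> 1 * (1 - p) + 1 * p"
    using assms by (intro add_mono mult_right_mono) (auto simp: pmf_le_1)
  then show ?thesis
    using binent_le_1[of "pmf q True * (1 - p) + pmf q False * p"] assms
    by (simp add: bsc_info_eq bsc_cap_def)
qed

lemma bsc_info_uniform:
  assumes "0 \<le> p" "p \<le> 1"
  shows "bsc_info p (bernoulli_pmf (1/2)) = bsc_cap p"
  using assms binent_half by (simp add: bsc_info_eq bsc_cap_def field_simps)

lemma max_over_bsc_info:
  assumes "0 \<le> p" "p \<le> 1"
  shows "max_over (bsc_info p) = bsc_cap p"
  using max_over_eqI[of "bsc_info p" "bernoulli_pmf (1/2)"] assms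
  by (simp add: bsc_info_uniform bsc_info_le)

text \<open>Uniform inputs maximise both terms at once, so the minimum attains its upper bound
  there; \<open>max_over\<close> needs such an attained value.\<close>

lemma max_over_min_bsc_info:
  assumes "0 \<le> p" "p \<le> 1" "0 \<le> p'" "p' \<le> 1"
  shows "max_over (\<lambda>(q, r). min (bsc_info p q) (bsc_info p' r)) = min (bsc_cap p) (bsc_cap p')"
proof -
  have "max_over (\<lambda>(q, r). min (bsc_info p q) (bsc_info p' r)) =
      (\<lambda>(q, r). min (bsc_info p q) (bsc_info p' r)) (bernoulli_pmf (1/2), bernoulli_pmf (1/2))"
    using assms
    by (intro max_over_eqI) (auto simp: bsc_info_uniform bsc_info_le min.coboundedI1 min.coboundedI2)
  then show ?thesis using assms by (simp add: bsc_info_uniform)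
qed

section \<open>Concentration of the self-information\<close>

abbreviation bsc_noise :: "'i set \<Rightarrow> ('i \<Rightarrow> real) \<Rightarrow> ('i \<Rightarrow> bool) pmf" where
  "bsc_noise I p \<equiv> Pi_pmf I False (\<lambda>x. bernoulli_pmf (p x))"

text \<open>Transfers error bounds for a single block code to the network: the noise read off from
  the global noise through the injection \<open>\<phi>\<close> is again independent, with the
  inherited levels. The induction splits off \<open>y\<close> from \<open>I\<close> and
  \<open>\<phi> y\<close> from \<open>A\<close>, hence \<open>A\<close> must vary.\<close>

lemma map_bsc_noise:
  assumes A: "finite A" and phi: "inj_on \<phi> I" "\<phi> ` I \<subseteq> A"
  shows "map_pmf (\<lambda>z x. if x \<in> I then z (\<phi> x) else False) (bsc_noise A p) =
    bsc_noise I (p \<circ> \<phi>)"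
proof -
  have "finite I" using A phi by (meson finite_imageD finite_subset)
  then show ?thesis using assms
  proof (induction I arbitrary: A)
    case empty
    then show ?case by (simp add: map_pmf_const)
  next
    case (insert y I)
    let ?A = "A - {\<phi> y}"
    let ?h = "\<lambda>z x. if x \<in> I then z (\<phi> x) else False"
    have A: "A = insert (\<phi> y) ?A" using insert.prems by auto
    have IH: "map_pmf ?h (bsc_noise ?A p) = bsc_noise I (p \<circ> \<phi>)"
      using insert.prems insert.hyps by (intro insert.IH) (auto simp: inj_on_def)
    have upd: "(\<lambda>x. if x \<in> insert y I then (z(\<phi> y := b)) (\<phi> x) else False) = (?h z)(y := b)" for b z
      using insert.prems insert.hyps by (auto simp: fun_eq_iff inj_on_def)
    let ?H = "\<lambda>z x. if x \<in> insert y I then z (\<phi> x) else False"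
    have "?H \<circ> (\<lambda>(b, z). z(\<phi> y := b)) = (\<lambda>(b, z). (?h z)(y := b))"
      by (rule ext) (simp only: o_def split_beta upd)
    moreover have "map_pmf ?H (bsc_noise A p) = map_pmf (?H \<circ> (\<lambda>(b, z). z(\<phi> y := b)))
        (pair_pmf (bernoulli_pmf (p (\<phi> y))) (bsc_noise ?A p))"
      unfolding pmf.map_comp[symmetric]
      using insert.prems by (subst A, subst Pi_pmf_insert) auto
    ultimately have "map_pmf ?H (bsc_noise A p) =
        map_pmf (\<lambda>(b, z). (?h z)(y := b)) (pair_pmf (bernoulli_pmf (p (\<phi> y))) (bsc_noise ?A p))"
      by simp
    also have "\<dots> = map_pmf (\<lambda>(b, z). z(y := b))
        (pair_pmf (bernoulli_pmf (p (\<phi> y))) (map_pmf ?h (bsc_noise ?A p)))"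
      by (simp add: pair_map_pmf2 pmf.map_comp o_def case_prod_unfold apsnd_def)
    also have "\<dots> = bsc_noise (insert y I) (p \<circ> \<phi>)"
      unfolding IH using insert.hyps by (simp add: Pi_pmf_insert)
    finally show ?case .
  qed
qed

text \<open>
  Since \<^term>\<open>log 2 0 = (0::real)\<close>, \<open>self_info 0 True = 0\<close> although this noise value is
  impossible; sets of likely noise vectors must therefore exclude it explicitly.
\<close>

definition self_info :: "real \<Rightarrow> bool \<Rightarrow> real" where
  "self_info q b = - log 2 (if b then q else 1 - q)"

text \<open>The range for Hoeffding's inequality: \<open>1 - q \<ge> 1/2\<close> costs at most one
  bit, and \<open>\<bar>log 2 q\<bar>\<close> covers the other value, including
  \<open>q = 0\<close>.\<close>

lemma self_info_bounds:
  assumes "0 \<le> q" "q \<le> 1/2"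
  shows "0 \<le> self_info q b" "self_info q b \<le> 1 + \<bar>log 2 q\<bar>"
proof -
  have "log 2 q \<le> 0" using assms by (cases "q = 0") (simp add: log_def, simp)
  moreover have "log 2 (1/2) \<le> log 2 (1 - q)" using assms by (intro log_mono) auto
  moreover have "log 2 (1 - q) \<le> 0" using assms by (subst log_le_zero_cancel_iff) auto
  ultimately show "0 \<le> self_info q b" "self_info q b \<le> 1 + \<bar>log 2 q\<bar>"
    unfolding self_info_def by (auto simp: log_divide simp del: log_le_zero_cancel_iff)
qed

lemma expectation_self_info:
  assumes "0 \<le> p" "p \<le> 1"
  shows "measure_pmf.expectation (bernoulli_pmf p) (self_info q) =
    - (p * log 2 q) - (1 - p) * log 2 (1 - q)"
  using assms by (simp add: self_info_def)

text \<open>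
  Coding for the noise level \<open>q\<close> is safe for every smaller level \<open>p\<close>.
\<close>

lemma cross_entropy_le:
  assumes "0 \<le> p" "p \<le> q" "q \<le> 1/2"
  shows "- (p * log 2 q) - (1 - p) * log 2 (1 - q) \<le> binent q"
proof (cases "q = 0")
  case True
  with assms show ?thesis by (simp add: binent_def)
next
  case False
  then have "log 2 q \<le> log 2 (1 - q)" using assms by (intro log_mono) auto
  \<comment> \<open>The cross entropy is affine in \<open>p\<close> with slope
    \<open>log 2 (1 - q) - log 2 q\<close> and equals \<open>binent q\<close> at
    \<open>p = q\<close>.\<close>
  then have "0 \<le> (q - p) * (log 2 (1 - q) - log 2 q)" using assms by auto
  then show ?thesis by (simp add: binent_def algebra_simps)
qed

section \<open>Hoeffding bounds for the self-information\<close>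

text \<open>The noise follows \<open>p\<close>, while its self-information is computed with the
  design level \<open>q\<close> that a code is built for. \<open>c\<close> is a common bound on the
  range of the summands.\<close>

locale noise_concentration =
  fixes I :: "'i set" and p q :: "'i \<Rightarrow> real" and c :: real
  assumes fin: "finite I" and nonempty: "I \<noteq> {}"
    and p_le: "\<And>x. x \<in> I \<Longrightarrow> 0 \<le> p x" "\<And>x. x \<in> I \<Longrightarrow> p x \<le> q x"
    and q_le: "\<And>x. x \<in> I \<Longrightarrow> q x \<le> 1/2"
    and c_ge: "c > 0" "\<And>x. x \<in> I \<Longrightarrow> 1 + \<bar>log 2 (q x)\<bar> \<le> c"
begin

sublocale Hoeffding_ineq "measure_pmf (bsc_noise I p)" I "\<lambda>x e. self_info (q x) (e x)" "\<lambda>_. 0" "\<lambda>_. c"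
    "\<Sum>x\<in>I. - (p x * log 2 (q x)) - (1 - p x) * log 2 (1 - q x)"
proof unfold_locales
  show "prob_space.indep_vars (measure_pmf (bsc_noise I p)) (\<lambda>_. borel) (\<lambda>x e. self_info (q x) (e x)) I"
    by (intro prob_space.indep_vars_compose2[OF _ indep_vars_Pi_pmf])
       (auto simp: measure_pmf.prob_space_axioms fin)
next
  fix x assume "x \<in> I"
  then show "AE e in measure_pmf (bsc_noise I p). self_info (q x) (e x) \<in> {0..c}"
    using self_info_bounds[of "q x"] p_le[of x] q_le[of x] c_ge(2)[of x]
    by (intro AE_I2) (auto intro: order_trans)
next
  have "measure_pmf.expectation (bsc_noise I p) (\<lambda>e. self_info (q x) (e x)) =
      - (p x * log 2 (q x)) - (1 - p x) * log 2 (1 - q x)" if x: "x \<in> I" for x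
  proof -
    have "measure_pmf.expectation (bsc_noise I p) (\<lambda>e. self_info (q x) (e x)) =
        measure_pmf.expectation (map_pmf (\<lambda>e. e x) (bsc_noise I p)) (self_info (q x))"
      by simp
    also have "\<dots> = - (p x * log 2 (q x)) - (1 - p x) * log 2 (1 - q x)"
      using p_le[OF x] q_le[OF x] expectation_self_info[of "p x" "q x"] by (simp add: Pi_pmf_component fin x)
    finally show ?thesis .
  qed
  then show "(\<Sum>x\<in>I. - (p x * log 2 (q x)) - (1 - p x) * log 2 (1 - q x)) \<equiv>
      \<Sum>x\<in>I. measure_pmf.expectation (bsc_noise I p) (\<lambda>e. self_info (q x) (e x))"
    by (intro eq_reflection sum.cong) auto
qed (auto simp: fin)

lemma card_pos: "card I > 0"
  using fin nonempty by (simp add: card_gt_0_iff)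

lemma hoeffding_rate:
  "exp (- 2 * (\<delta> * real (card I))\<^sup>2 / (\<Sum>x\<in>I. (c - 0)\<^sup>2)) = exp (- (2 * \<delta>\<^sup>2 / c\<^sup>2) * real (card I))"
  using c_ge card_pos by (simp add: power_mult_distrib power2_eq_square)

text \<open>By \<open>cross_entropy_le\<close> the mean is at most the entropy of \<open>q\<close>,
  so the event lies in a Hoeffding tail. For the lower tail the mean must not fall under that
  entropy, which is why \<open>p\<close> and \<open>q\<close> agree there.\<close>

lemma self_info_upper_tail:
  fixes \<delta> :: real
  assumes "\<delta> > 0"
  shows "measure_pmf.prob (bsc_noise I p)
      {e. (\<Sum>x\<in>I. self_info (q x) (e x)) > (\<Sum>x\<in>I. binent (q x)) + \<delta> * real (card I)}
    \<le> exp (- (2 * \<delta>\<^sup>2 / c\<^sup>2) * real (card I))"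
proof -
  have "(\<Sum>x\<in>I. - (p x * log 2 (q x)) - (1 - p x) * log 2 (1 - q x)) \<le> (\<Sum>x\<in>I. binent (q x))"
    using p_le q_le by (intro sum_mono cross_entropy_le) auto
  then have "measure_pmf.prob (bsc_noise I p)
      {e. (\<Sum>x\<in>I. self_info (q x) (e x)) > (\<Sum>x\<in>I. binent (q x)) + \<delta> * real (card I)} \<le>
    measure_pmf.prob (bsc_noise I p) {e\<in>space (measure_pmf (bsc_noise I p)).
      (\<Sum>x\<in>I. self_info (q x) (e x)) \<ge>
      (\<Sum>x\<in>I. - (p x * log 2 (q x)) - (1 - p x) * log 2 (1 - q x)) + \<delta> * real (card I)}"
    by (intro measure_pmf.finite_measure_mono) auto
  also have "\<dots> \<le> exp (- (2 * \<delta>\<^sup>2 / c\<^sup>2) * real (card I))"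
    unfolding hoeffding_rate[symmetric]
    using assms c_ge card_pos by (intro Hoeffding_ineq_ge) auto
  finally show ?thesis .
qed

lemma self_info_lower_tail:
  fixes \<delta> :: real
  assumes "\<delta> > 0" "\<And>x. x \<in> I \<Longrightarrow> p x = q x"
  shows "measure_pmf.prob (bsc_noise I p)
      {e. (\<Sum>x\<in>I. self_info (q x) (e x)) < (\<Sum>x\<in>I. binent (q x)) - \<delta> * real (card I)}
    \<le> exp (- (2 * \<delta>\<^sup>2 / c\<^sup>2) * real (card I))"
proof -
  have "(\<Sum>x\<in>I. - (p x * log 2 (q x)) - (1 - p x) * log 2 (1 - q x)) = (\<Sum>x\<in>I. binent (q x))"
    using assms(2) by (intro sum.cong) (auto simp: binent_def)
  then have "measure_pmf.prob (bsc_noise I p)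
      {e. (\<Sum>x\<in>I. self_info (q x) (e x)) < (\<Sum>x\<in>I. binent (q x)) - \<delta> * real (card I)} \<le>
    measure_pmf.prob (bsc_noise I p) {e\<in>space (measure_pmf (bsc_noise I p)).
      (\<Sum>x\<in>I. self_info (q x) (e x)) \<le>
      (\<Sum>x\<in>I. - (p x * log 2 (q x)) - (1 - p x) * log 2 (1 - q x)) - \<delta> * real (card I)}"
    by (intro measure_pmf.finite_measure_mono) auto
  also have "\<dots> \<le> exp (- (2 * \<delta>\<^sup>2 / c\<^sup>2) * real (card I))"
    unfolding hoeffding_rate[symmetric]
    using assms c_ge card_pos by (intro Hoeffding_ineq_le) auto
  finally show ?thesis .
qed

end

lemma prod_eq_self_info:
  assumes "finite I" "\<And>x. x \<in> I \<Longrightarrow> 0 \<le> q x" "\<And>x. x \<in> I \<Longrightarrow> q x \<le> 1/2"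
    and "\<And>x. x \<in> I \<Longrightarrow> q x = 0 \<Longrightarrow> \<not> e x"
  shows "(\<Prod>x\<in>I. pmf (bernoulli_pmf (q x)) (e x)) = 2 powr - (\<Sum>x\<in>I. self_info (q x) (e x))"
proof -
  have "2 powr - (\<Sum>x\<in>I. self_info (q x) (e x)) = (\<Prod>x\<in>I. 2 powr - self_info (q x) (e x))"
    using assms(1) by (simp add: powr_sum flip: sum_negf)
  also have "\<dots> = (\<Prod>x\<in>I. pmf (bernoulli_pmf (q x)) (e x))"
  proof (intro prod.cong refl)
    fix x assume "x \<in> I"
    then show "2 powr - self_info (q x) (e x) = pmf (bernoulli_pmf (q x)) (e x)"
      using assms(2,3,4)[of x] by (cases "q x = 0"; cases "e x"; simp add: self_info_def)
  qed
  finally show ?thesis by simp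
qed

lemma noise_zero:
  assumes "finite I" "x \<in> I" "p x = 0" "e \<in> set_pmf (bsc_noise I p)"
  shows "\<not> e x"
proof -
  have "e x \<in> set_pmf (bernoulli_pmf (p x))"
    using assms(1,2,4) unfolding set_Pi_pmf[OF assms(1)] PiE_dflt_def by simp
  then show ?thesis using assms(3) by (cases "e x") (auto simp: set_pmf_eq)
qed

section \<open>Codes for additive noise\<close>

text \<open>Vectors are total functions that are \<open>False\<close> off \<open>I\<close>, the
  default value used in \<open>bsc_noise\<close>; so for finite \<open>I\<close> the cube is finite
  and supports the noise.\<close>

abbreviation cube :: "'i set \<Rightarrow> ('i \<Rightarrow> bool) set" where
  "cube I \<equiv> PiE_dflt I False (\<lambda>_. UNIV)"

definition vxor :: "('i \<Rightarrow> bool) \<Rightarrow> ('i \<Rightarrow> bool) \<Rightarrow> 'i \<Rightarrow> bool" where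
  "vxor x y = (\<lambda>i. x i \<noteq> y i)"

lemma cube_iff: "x \<in> cube I \<longleftrightarrow> (\<forall>i. i \<notin> I \<longrightarrow> \<not> x i)"
  by (auto simp: PiE_dflt_def)

lemma finite_cube: "finite I \<Longrightarrow> finite (cube I)"
  by (intro finite_PiE_dflt) auto

lemma card_cube: "finite I \<Longrightarrow> card (cube I) = 2 ^ card I"
  by (subst card_PiE_dflt) auto

lemma vxor_cube: "x \<in> cube I \<Longrightarrow> y \<in> cube I \<Longrightarrow> vxor x y \<in> cube I"
  unfolding cube_iff vxor_def by simp

lemma vxor_left_cancel [simp]: "vxor x (vxor x y) = y"
  by (auto simp: vxor_def)

lemma inj_vxor: "inj_on (vxor x) A"
  by (rule inj_on_inverseI[of _ "vxor x"]) (rule vxor_left_cancel)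

lemma vxor_commute: "vxor x y = vxor y x"
  by (auto simp: vxor_def)

lemma set_bsc_noise_subset: "finite I \<Longrightarrow> set_pmf (bsc_noise I p) \<subseteq> cube I"
  using set_Pi_pmf_subset'[of I False "\<lambda>x. bernoulli_pmf (p x)"] by (auto simp: PiE_dflt_def)

lemma prob_finite_support:
  assumes "finite G" "set_pmf \<nu> \<subseteq> G"
  shows "measure_pmf.prob \<nu> A = (\<Sum>e\<in>G. if e \<in> A then pmf \<nu> e else 0)"
proof -
  have "measure_pmf.prob \<nu> A = measure_pmf.prob \<nu> (A \<inter> G)"
    using assms(2) by (intro measure_prob_cong_0) (auto simp: set_pmf_eq)
  also have "\<dots> = sum (pmf \<nu>) (A \<inter> G)"
    using assms(1) by (intro measure_measure_pmf_finite) auto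
  also have "\<dots> = (\<Sum>e\<in>G. if e \<in> A then pmf \<nu> e else 0)"
    using assms(1) by (subst Int_commute, subst sum.inter_restrict) auto
  finally show ?thesis .
qed

lemma pmf_bsc_noise:
  assumes "finite I" "\<And>x. x \<in> I \<Longrightarrow> 0 \<le> q x" "\<And>x. x \<in> I \<Longrightarrow> q x \<le> 1/2"
    and "\<And>x. x \<in> I \<Longrightarrow> q x = 0 \<Longrightarrow> \<not> e x" and "e \<in> cube I"
  shows "pmf (bsc_noise I q) e = 2 powr - (\<Sum>x\<in>I. self_info (q x) (e x))"
  using prod_eq_self_info[of I q e] assms by (subst pmf_Pi') (auto simp: cube_iff)

section \<open>Counting bound on the success probability\<close>

text \<open>Correct decoding means little self-information or a noise vector in \<open>A w\<close>.
  Translation by \<open>x w\<close> embeds \<open>A w\<close> into the decision region of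
  \<open>w\<close>; the regions are disjoint, so the \<open>A w\<close> have at most
  \<open>2 ^ card I\<close> members in total, each of probability at most
  \<open>2 powr - a\<close>.\<close>

lemma additive_converse:
  fixes x :: "nat \<Rightarrow> 'i \<Rightarrow> bool" and p :: "'i \<Rightarrow> real" and a :: real
  assumes I: "finite I" and p: "\<And>i. i \<in> I \<Longrightarrow> 0 \<le> p i" "\<And>i. i \<in> I \<Longrightarrow> p i \<le> 1/2"
    and x: "\<And>w. w < M \<Longrightarrow> x w \<in> cube I" and M: "M > 0"
  shows "(\<Sum>w<M. measure_pmf.prob (bsc_noise I p) {e. g (vxor (x w) e) = w}) / M
    \<le> measure_pmf.prob (bsc_noise I p) {e. (\<Sum>i\<in>I. self_info (p i) (e i)) < a}
      + 2 powr (card I - a) / M"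
proof -
  let ?\<nu> = "bsc_noise I p" and ?L = "\<lambda>e. \<Sum>i\<in>I. self_info (p i) (e i)"
  \<comment> \<open>The condition at \<open>p i = 0\<close> makes the mass of a member equal to
    \<open>2 powr - ?L e\<close>, despite \<open>log 2 0 = 0\<close>.\<close>
  define A where "A = (\<lambda>w. {e \<in> cube I. g (vxor (x w) e) = w \<and> (\<forall>i\<in>I. p i = 0 \<longrightarrow> \<not> e i) \<and> a \<le> ?L e})"
  have fin: "finite (A w)" for w unfolding A_def using finite_cube[OF I] by auto
  have prob_A: "measure_pmf.prob ?\<nu> (A w) \<le> card (A w) * 2 powr - a" for w
  proof -
    have "measure_pmf.prob ?\<nu> (A w) = sum (pmf ?\<nu>) (A w)"
      by (rule measure_measure_pmf_finite[OF fin])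
    also have "\<dots> \<le> (\<Sum>e\<in>A w. 2 powr - a)"
    proof (rule sum_mono)
      fix e assume "e \<in> A w"
      then show "pmf ?\<nu> e \<le> 2 powr - a"
        using I p by (subst pmf_bsc_noise) (auto simp: A_def)
    qed
    finally show ?thesis by simp
  qed
  have card_sum: "(\<Sum>w<M. card (A w)) \<le> card (cube I)"
  proof -
    have "(\<Sum>w<M. card (A w)) \<le> (\<Sum>w<M. card {y \<in> cube I. g y = w})"
    proof (rule sum_mono)
      fix w assume "w \<in> {..<M}"
      then show "card (A w) \<le> card {y \<in> cube I. g y = w}"
        using x finite_cube[OF I] by (intro card_inj_on_le[OF inj_vxor[of "x w"]])
          (auto simp: A_def intro!: vxor_cube)
    qed
    also have "\<dots> = card (\<Union>w\<in>{..<M}. {y \<in> cube I. g y = w})"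
      using finite_cube[OF I] by (intro card_UN_disjoint[symmetric]) auto
    also have "\<dots> \<le> card (cube I)"
      using finite_cube[OF I] by (intro card_mono) auto
    finally show ?thesis .
  qed
  have card_A: "real (\<Sum>w<M. card (A w)) \<le> 2 powr card I"
  proof -
    have "real (\<Sum>w<M. card (A w)) \<le> real (card (cube I))" using card_sum by (rule of_nat_mono)
    then show ?thesis by (simp add: card_cube[OF I] powr_realpow)
  qed
  have "(\<Sum>w<M. measure_pmf.prob ?\<nu> {e. g (vxor (x w) e) = w})
      \<le> (\<Sum>w<M. measure_pmf.prob ?\<nu> {e. ?L e < a} + card (A w) * 2 powr - a)"
  proof (rule sum_mono)
    fix w
    have "measure_pmf.prob ?\<nu> {e. g (vxor (x w) e) = w} \<le> measure_pmf.prob ?\<nu> ({e. ?L e < a} \<union> A w)"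
    proof (rule measure_pmf.finite_measure_mono_AE)
      show "AE e in measure_pmf ?\<nu>. e \<in> {e. g (vxor (x w) e) = w} \<longrightarrow> e \<in> {e. ?L e < a} \<union> A w"
      proof (rule AE_pmfI)
        fix e assume "e \<in> set_pmf ?\<nu>"
        then have "e \<in> cube I" "\<forall>i\<in>I. p i = 0 \<longrightarrow> \<not> e i"
          using set_bsc_noise_subset[OF I] noise_zero[OF I] by blast+
        then show "e \<in> {e. g (vxor (x w) e) = w} \<longrightarrow> e \<in> {e. ?L e < a} \<union> A w"
          unfolding A_def by auto
      qed
    qed simp
    also have "\<dots> \<le> measure_pmf.prob ?\<nu> {e. ?L e < a} + measure_pmf.prob ?\<nu> (A w)"
      by (rule measure_Un_le) auto
    finally show "measure_pmf.prob ?\<nu> {e. g (vxor (x w) e) = w}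
        \<le> measure_pmf.prob ?\<nu> {e. ?L e < a} + card (A w) * 2 powr - a"
      using prob_A[of w] by linarith
  qed
  also have "\<dots> = M * measure_pmf.prob ?\<nu> {e. ?L e < a} + real (\<Sum>w<M. card (A w)) * 2 powr - a"
    by (simp add: sum.distrib sum_distrib_right)
  also have "\<dots> \<le> M * measure_pmf.prob ?\<nu> {e. ?L e < a} + 2 powr card I * 2 powr - a"
    using card_A by (intro add_left_mono mult_right_mono) auto
  also have "2 powr card I * 2 powr - a = 2 powr (card I - a)"
    by (simp flip: powr_add)
  finally show ?thesis using M by (simp add: field_simps)
qed

section \<open>Greedy codes\<close>

text \<open>Averaging over all words \<open>c\<close>: for each fixed \<open>e\<close> at most
  \<open>card S\<close> of them satisfy \<open>vxor c e \<in> S\<close>, whatever the law of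
  \<open>e\<close>. Summing over \<open>F\<close> before averaging yields one \<open>c\<close> that
  is good for every \<open>k\<close>.\<close>

lemma code_extension:
  assumes I: "finite I" and F: "finite F" and \<nu>: "\<And>k. k \<in> F \<Longrightarrow> set_pmf (\<nu> k) \<subseteq> cube I"
    and S: "S \<subseteq> cube I"
  shows "\<exists>c\<in>cube I. \<forall>k\<in>F. measure_pmf.prob (\<nu> k) {e. vxor c e \<in> S} \<le> card F * card S / 2 ^ card I"
proof -
  let ?P = "\<lambda>c k. measure_pmf.prob (\<nu> k) {e. vxor c e \<in> S}"
  note fin = finite_cube[OF I]
  have avg: "(\<Sum>c\<in>cube I. ?P c k) \<le> card S" if k: "k \<in> F" for k
  proof -
    have "(\<Sum>c\<in>cube I. ?P c k) = (\<Sum>c\<in>cube I. \<Sum>e\<in>cube I. if vxor c e \<in> S then pmf (\<nu> k) e else 0)"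
      by (subst prob_finite_support[OF fin \<nu>[OF k]]) simp
    also have "\<dots> = (\<Sum>e\<in>cube I. \<Sum>c\<in>cube I. if vxor c e \<in> S then pmf (\<nu> k) e else 0)"
      by (rule sum.swap)
    also have "\<dots> = (\<Sum>e\<in>cube I. card {c\<in>cube I. vxor c e \<in> S} * pmf (\<nu> k) e)"
      using fin by (simp flip: sum.inter_filter)
    also have "\<dots> \<le> (\<Sum>e\<in>cube I. card S * pmf (\<nu> k) e)"
    proof (intro sum_mono mult_right_mono)
      fix e
      have "card {c\<in>cube I. vxor c e \<in> S} \<le> card S"
        using finite_subset[OF S fin]
        by (intro card_inj_on_le[OF inj_vxor[of e]]) (auto simp: vxor_commute[of e])
      then show "real (card {c\<in>cube I. vxor c e \<in> S}) \<le> card S" by simp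
    qed simp
    also have "\<dots> = card S"
      using sum_pmf_eq_1[OF fin \<nu>[OF k]] by (simp flip: sum_distrib_left)
    finally show ?thesis .
  qed
  have "\<exists>c\<in>cube I. (\<Sum>k\<in>F. ?P c k) \<le> card F * card S / 2 ^ card I"
  proof (rule ccontr)
    assume "\<not> ?thesis"
    then have "(\<Sum>c\<in>cube I. card F * card S / 2 ^ card I) < (\<Sum>c\<in>cube I. \<Sum>k\<in>F. ?P c k)"
      using fin by (intro sum_strict_mono) (auto simp: not_le)
    also have "\<dots> = (\<Sum>k\<in>F. \<Sum>c\<in>cube I. ?P c k)" by (rule sum.swap)
    also have "\<dots> \<le> (\<Sum>k\<in>F. real (card S))" using avg by (intro sum_mono) auto
    finally show False by (simp add: card_cube[OF I])
  qed
  then obtain c where c: "c \<in> cube I" "(\<Sum>k\<in>F. ?P c k) \<le> card F * card S / 2 ^ card I" by blast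
  have "?P c k \<le> (\<Sum>k\<in>F. ?P c k)" if "k \<in> F" for k
    using F that by (intro member_le_sum) auto
  with c show ?thesis by (meson order_trans)
qed

text \<open>The decoder returns the first index whose codeword differs from the received word by an
  element of \<open>T\<close>. It fails only if the noise leaves \<open>T\<close> or an earlier
  codeword also fits; each new codeword is chosen to make the latter unlikely.\<close>

lemma greedy_code:
  assumes I: "finite I" and F: "finite F" and \<nu>: "\<And>k. k \<in> F \<Longrightarrow> set_pmf (\<nu> k) \<subseteq> cube I"
    and T: "T \<subseteq> cube I"
  shows "\<exists>x d. \<forall>w<M. x w \<in> cube I \<and> (\<forall>k\<in>F. measure_pmf.prob (\<nu> k) {e. d (vxor (x w) e) \<noteq> w}
    \<le> measure_pmf.prob (\<nu> k) (- T) + card F * M * card T / 2 ^ card I)"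
proof -
  note fin = finite_cube[OF I] and finT = finite_subset[OF T finite_cube[OF I]]
  let ?B = "\<lambda>x w. {e. \<exists>v<w. vxor (x v) (vxor (x w) e) \<in> T}"
  have "\<exists>x. \<forall>w<M. x w \<in> cube I \<and>
      (\<forall>k\<in>F. measure_pmf.prob (\<nu> k) (?B x w) \<le> card F * M * card T / 2 ^ card I)"
  proof (induction M)
    case 0
    then show ?case by simp
  next
    case (Suc M)
    then obtain x where x: "\<And>w. w < M \<Longrightarrow> x w \<in> cube I"
      "\<And>w k. w < M \<Longrightarrow> k \<in> F \<Longrightarrow> measure_pmf.prob (\<nu> k) (?B x w) \<le> card F * M * card T / 2 ^ card I"
      by blast
    \<comment> \<open>Received words that some earlier codeword explains; there are at most
      \<open>M * card T\<close> of them.\<close>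
    define S where "S = (\<Union>v\<in>{..<M}. vxor (x v) ` T)"
    have S_iff: "y \<in> S \<longleftrightarrow> (\<exists>v<M. vxor (x v) y \<in> T)" for y
    proof
      assume "y \<in> S"
      then show "\<exists>v<M. vxor (x v) y \<in> T" unfolding S_def by auto
    next
      assume "\<exists>v<M. vxor (x v) y \<in> T"
      then obtain v where "v < M" "vxor (x v) y \<in> T" by blast
      then show "y \<in> S" unfolding S_def
        by (intro UN_I[of v] image_eqI[of _ _ "vxor (x v) y"]) (auto simp: vxor_left_cancel)
    qed
    have "S \<subseteq> cube I" unfolding S_def using x(1) T by (auto intro!: vxor_cube)
    from code_extension[where \<nu> = \<nu>, OF I F \<nu> this] obtain c where c: "c \<in> cube I"
      "\<And>k. k \<in> F \<Longrightarrow> measure_pmf.prob (\<nu> k) {e. vxor c e \<in> S} \<le> card F * card S / 2 ^ card I"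
      by blast
    have "card S \<le> (\<Sum>v<M. card (vxor (x v) ` T))" unfolding S_def by (rule card_UN_le) simp
    also have "\<dots> \<le> (\<Sum>v<M. card T)" using finT by (intro sum_mono card_image_le)
    finally have "card S \<le> Suc M * card T" by simp
    then have "card F * card S \<le> card F * Suc M * card T"
      unfolding mult.assoc by (rule mult_left_mono) simp
    then have new: "card F * card S / 2 ^ card I \<le> card F * Suc M * card T / (2 ^ card I :: real)"
      by (intro divide_right_mono of_nat_mono) auto
    have old: "card F * M * card T / 2 ^ card I \<le> card F * Suc M * card T / (2 ^ card I :: real)"
      by (intro divide_right_mono of_nat_mono mult_left_mono mult_right_mono) auto
    show ?case
    proof (intro exI[of _ "x(M := c)"] allI impI conjI ballI)
      fix w assume w: "w < Suc M"
      show "(x(M := c)) w \<in> cube I" using w x(1) c(1) by (cases "w = M") auto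
      fix k assume k: "k \<in> F"
      show "measure_pmf.prob (\<nu> k) (?B (x(M := c)) w) \<le> card F * Suc M * card T / 2 ^ card I"
      proof (cases "w = M")
        case True
        then have eq: "?B (x(M := c)) w = {e. vxor c e \<in> S}"
          unfolding S_iff by auto
        show ?thesis unfolding eq using c(2)[OF k] new by linarith
      next
        case False
        with w have "w < M" by simp
        \<comment> \<open>The error event of \<open>w\<close> involves only codewords up to
          \<open>w\<close>, so the bounds for earlier messages persist when a word is
          appended.\<close>
        then have eq: "?B (x(M := c)) w = ?B x w"
          by (intro Collect_cong ex_cong1) auto
        show ?thesis unfolding eq using x(2)[OF \<open>w < M\<close> k] old by linarith
      qed
    qed
  qed
  then obtain x where x: "\<And>w. w < M \<Longrightarrow> x w \<in> cube I"
    "\<And>w k. w < M \<Longrightarrow> k \<in> F \<Longrightarrow> measure_pmf.prob (\<nu> k) (?B x w) \<le> card F * M * card T / 2 ^ card I"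
    by blast
  define d where "d = (\<lambda>y. LEAST v. vxor (x v) y \<in> T)"
  have "measure_pmf.prob (\<nu> k) {e. d (vxor (x w) e) \<noteq> w}
      \<le> measure_pmf.prob (\<nu> k) (- T) + card F * M * card T / 2 ^ card I" if w: "w < M" and k: "k \<in> F" for w k
  proof -
    have "{e. d (vxor (x w) e) \<noteq> w} \<subseteq> - T \<union> ?B x w"
    proof
      fix e assume e: "e \<in> {e. d (vxor (x w) e) \<noteq> w}"
      show "e \<in> - T \<union> ?B x w"
      proof (rule ccontr)
        assume "e \<notin> - T \<union> ?B x w"
        then have "vxor (x w) (vxor (x w) e) \<in> T" "\<And>v. vxor (x v) (vxor (x w) e) \<in> T \<Longrightarrow> w \<le> v"
          by (auto simp: vxor_left_cancel not_less[symmetric])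
        then have "d (vxor (x w) e) = w" unfolding d_def by (rule Least_equality)
        with e show False by simp
      qed
    qed
    then have "measure_pmf.prob (\<nu> k) {e. d (vxor (x w) e) \<noteq> w} \<le> measure_pmf.prob (\<nu> k) (- T \<union> ?B x w)"
      by (intro measure_pmf.finite_measure_mono) auto
    also have "\<dots> \<le> measure_pmf.prob (\<nu> k) (- T) + measure_pmf.prob (\<nu> k) (?B x w)"
      by (rule measure_Un_le) auto
    finally show ?thesis using x(2)[OF w k] by linarith
  qed
  with x(1) show ?thesis by blast
qed

text \<open>The code depends on the majorant \<open>q\<close> only, so it serves all noise laws \<open>p k\<close> at once.\<close>

lemma channel_code:
  fixes p :: "'k \<Rightarrow> 'i \<Rightarrow> real" and q :: "'i \<Rightarrow> real" and \<delta> c :: real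
  assumes I: "finite I" "I \<noteq> {}" and F: "finite F"
    and p: "\<And>k i. k \<in> F \<Longrightarrow> i \<in> I \<Longrightarrow> 0 \<le> p k i" "\<And>k i. k \<in> F \<Longrightarrow> i \<in> I \<Longrightarrow> p k i \<le> q i"
    and q: "\<And>i. i \<in> I \<Longrightarrow> 0 \<le> q i" "\<And>i. i \<in> I \<Longrightarrow> q i \<le> 1/2"
    and c: "c > 0" "\<And>i. i \<in> I \<Longrightarrow> 1 + \<bar>log 2 (q i)\<bar> \<le> c" and \<delta>: "\<delta> > 0"
  shows "\<exists>x d. \<forall>w<M. x w \<in> cube I \<and> (\<forall>k\<in>F. measure_pmf.prob (bsc_noise I (p k)) {e. d (vxor (x w) e) \<noteq> w}
    \<le> exp (- (2 * \<delta>\<^sup>2 / c\<^sup>2) * real (card I))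
      + card F * M * 2 powr (\<delta> * card I - (\<Sum>i\<in>I. bsc_cap (q i))))"
proof -
  let ?L = "\<lambda>e. \<Sum>i\<in>I. self_info (q i) (e i)" and ?a = "(\<Sum>i\<in>I. binent (q i)) + \<delta> * real (card I)"
  \<comment> \<open>Each member of \<open>T\<close> has mass at least \<open>2 powr - ?a\<close>
    under the majorant \<open>q\<close>, hence \<open>T\<close> has at most \<open>2 powr ?a\<close>
    members.\<close>
  define T where "T = {e \<in> cube I. (\<forall>i\<in>I. q i = 0 \<longrightarrow> \<not> e i) \<and> ?L e \<le> ?a}"
  have finT: "finite T" unfolding T_def using finite_cube[OF I(1)] by auto
  have "card T * 2 powr - ?a = (\<Sum>e\<in>T. 2 powr - ?a)" by simp
  also have "\<dots> \<le> (\<Sum>e\<in>T. pmf (bsc_noise I q) e)"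
  proof (rule sum_mono)
    fix e assume "e \<in> T"
    then show "2 powr - ?a \<le> pmf (bsc_noise I q) e"
      using I q by (subst pmf_bsc_noise) (auto simp: T_def)
  qed
  also have "\<dots> = measure_pmf.prob (bsc_noise I q) T"
    by (rule measure_measure_pmf_finite[OF finT, symmetric])
  also have "\<dots> \<le> 1" by simp
  finally have card_T: "card T \<le> 2 powr ?a" by (simp only: powr_minus) (simp add: field_simps)
  have "?a - card I = \<delta> * card I - (\<Sum>i\<in>I. bsc_cap (q i))"
    by (simp add: bsc_cap_def sum_subtractf)
  then have ratio: "2 powr ?a / 2 ^ card I = 2 powr (\<delta> * card I - (\<Sum>i\<in>I. bsc_cap (q i)))"
    by (metis powr_diff powr_realpow zero_less_numeral)
  have tail: "measure_pmf.prob (bsc_noise I (p k)) (- T) \<le> exp (- (2 * \<delta>\<^sup>2 / c\<^sup>2) * real (card I))"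
    if k: "k \<in> F" for k
  proof -
    have pk: "0 \<le> p k i" "p k i \<le> q i" if "i \<in> I" for i
      using p k that by auto
    interpret noise_concentration I "p k" q c
      using I pk q c by unfold_locales auto
    have "measure_pmf.prob (bsc_noise I (p k)) (- T) \<le> measure_pmf.prob (bsc_noise I (p k)) {e. ?L e > ?a}"
    proof (rule measure_pmf.finite_measure_mono_AE)
      show "AE e in measure_pmf (bsc_noise I (p k)). e \<in> - T \<longrightarrow> e \<in> {e. ?L e > ?a}"
      proof (rule AE_pmfI)
        fix e assume e: "e \<in> set_pmf (bsc_noise I (p k))"
        then have "e \<in> cube I" using set_bsc_noise_subset[OF I(1)] by blast
        \<comment> \<open>\<open>q i = 0\<close> forces \<open>p k i = 0\<close>, so every law
          \<open>p k\<close> is noiseless in the coordinates where \<open>T\<close> forbids a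
          one.\<close>
        moreover have "\<forall>i\<in>I. q i = 0 \<longrightarrow> \<not> e i"
          using noise_zero[OF I(1) _ _ e] pk by (metis order_antisym)
        ultimately show "e \<in> - T \<longrightarrow> e \<in> {e. ?L e > ?a}" unfolding T_def by auto
      qed
    qed simp
    then show ?thesis using self_info_upper_tail[OF \<delta>] by linarith
  qed
  have "T \<subseteq> cube I" unfolding T_def by auto
  then obtain x d where xd: "\<And>w. w < M \<Longrightarrow> x w \<in> cube I"
    "\<And>w k. w < M \<Longrightarrow> k \<in> F \<Longrightarrow> measure_pmf.prob (bsc_noise I (p k)) {e. d (vxor (x w) e) \<noteq> w}
    \<le> measure_pmf.prob (bsc_noise I (p k)) (- T) + card F * M * card T / 2 ^ card I"
    using greedy_code[OF I(1) F set_bsc_noise_subset[OF I(1)], of T M p] by blast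
  have "card F * M * card T / 2 ^ card I \<le> card F * M * 2 powr (\<delta> * card I - (\<Sum>i\<in>I. bsc_cap (q i)))"
    unfolding ratio[symmetric] times_divide_eq_right of_nat_mult
    using card_T by (intro divide_right_mono mult_left_mono) auto
  with xd tail show ?thesis by (intro exI[of _ x] exI[of _ d]) (auto intro!: order_trans[OF xd(2)] add_mono)
qed

section \<open>Converse\<close>

lemma prob_pair_pmf:
  "measure_pmf.prob (pair_pmf A B) {(a, b). P a b} =
    measure_pmf.expectation A (\<lambda>a. measure_pmf.prob B {b. P a b})"
proof -
  have eq: "measure_pmf.prob D {x. Q x} = pmf (map_pmf Q D) True" for D :: "'c pmf" and Q
    unfolding pmf_map by (intro arg_cong[where f = "measure_pmf.prob D"]) auto
  have "measure_pmf.prob (pair_pmf A B) {(a, b). P a b} = pmf (map_pmf (case_prod P) (pair_pmf A B)) True"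
    by (subst eq[symmetric]) (auto intro!: arg_cong[where f = "measure_pmf.prob _"])
  also have "map_pmf (case_prod P) (pair_pmf A B) = bind_pmf A (\<lambda>a. map_pmf (P a) B)"
    unfolding pair_pmf_def map_bind_pmf by (simp add: map_pmf_def bind_assoc_pmf bind_return_pmf)
  also have "pmf \<dots> True = measure_pmf.expectation A (\<lambda>a. measure_pmf.prob B {b. P a b})"
    unfolding pmf_bind eq ..
  finally show ?thesis .
qed

lemma prob_pair_pmf':
  "measure_pmf.prob (pair_pmf A B) {(a, b). P a b} =
    measure_pmf.expectation B (\<lambda>b. measure_pmf.prob A {a. P a b})"
proof -
  have "measure_pmf.prob (pair_pmf A B) {(a, b). P a b} = measure_pmf.prob (pair_pmf B A) {(b, a). P a b}"
    by (subst pair_commute_pmf) (auto simp: vimage_def case_prod_unfold intro!: arg_cong[where f = "measure_pmf.prob _"])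
  then show ?thesis by (simp add: prob_pair_pmf)
qed

lemma integrable_prob [simp]: "integrable (measure_pmf A) (\<lambda>a. measure_pmf.prob (B a) (P a))"
  by (rule measure_pmf.integrable_const_bound[of _ 1]) auto

lemma noise_pmf_eq: "noise_pmf K n p = bsc_noise ({1..K} \<times> {1..n}) (p \<circ> fst)"
  by (simp add: noise_pmf_def case_prod_unfold)

lemma success_prob_eq:
  assumes "M > 0"
  shows "1 - error_prob K ps pd M n c =
    (\<Sum>w<M. measure_pmf.prob (pair_pmf (noise_pmf K n ps) (noise_pmf K n pd)) {(z, e). decoded K n c w z e = w}) / M"
proof -
  let ?D = "pair_pmf (noise_pmf K n ps) (noise_pmf K n pd)"
  let ?W = "pmf_of_set {0..<M}"
  have "1 - error_prob K ps pd M n c =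
      measure_pmf.prob (pair_pmf ?W ?D) (- {(w, z, e). decoded K n c w z e \<noteq> w})"
    unfolding error_prob_def by (subst measure_pmf.prob_compl[symmetric]) (auto simp: Compl_eq_Diff_UNIV)
  also have "- {(w, z, e). decoded K n c w z e \<noteq> w} = {(w, ze). (\<lambda>(z, e). decoded K n c w z e = w) ze}"
    by auto
  also have "measure_pmf.prob (pair_pmf ?W ?D) \<dots> =
      (\<Sum>w<M. measure_pmf.prob ?D {(z, e). decoded K n c w z e = w}) / M"
    unfolding prob_pair_pmf using assms
    by (subst integral_pmf_of_set) (auto simp: lessThan_atLeast0)
  finally show ?thesis .
qed

text \<open>The relay noise \<open>z\<close> is frozen; a bound uniform in \<open>z\<close> survives
  averaging. The next lemma freezes the destination noise instead.\<close>

lemma success_prob_le_dest: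
  assumes "M > 0"
    and "\<And>z. (\<Sum>w<M. measure_pmf.prob (noise_pmf K n pd) {e. decoded K n c w z e = w}) / M \<le> b"
  shows "1 - error_prob K ps pd M n c \<le> b"
proof -
  have "1 - error_prob K ps pd M n c = measure_pmf.expectation (noise_pmf K n ps)
      (\<lambda>z. (\<Sum>w<M. measure_pmf.prob (noise_pmf K n pd) {e. decoded K n c w z e = w}) / M)"
    unfolding success_prob_eq[OF assms(1)] prob_pair_pmf by simp
  also have "\<dots> \<le> b"
    using assms(2) by (intro measure_pmf.integral_le_const) auto
  finally show ?thesis .
qed

lemma success_prob_le_relay:
  assumes "M > 0"
    and "\<And>e. (\<Sum>w<M. measure_pmf.prob (noise_pmf K n ps) {z. decoded K n c w z e = w}) / M \<le> b"
  shows "1 - error_prob K ps pd M n c \<le> b"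
proof -
  have "1 - error_prob K ps pd M n c = measure_pmf.expectation (noise_pmf K n pd)
      (\<lambda>e. (\<Sum>w<M. measure_pmf.prob (noise_pmf K n ps) {z. decoded K n c w z e = w}) / M)"
    unfolding success_prob_eq[OF assms(1)] prob_pair_pmf' by simp
  also have "\<dots> \<le> b"
    using assms(2) by (intro measure_pmf.integral_le_const) auto
  finally show ?thesis .
qed

lemma num_messages_bounds:
  assumes "0 \<le> R"
  shows "2 powr (real n * R) \<le> num_messages n R" "num_messages n R > 0"
proof -
  have "0 < 2 powr (real n * R)" by simp
  then have "0 < \<lceil>2 powr (real n * R)\<rceil>" by linarith
  then show "num_messages n R > 0" unfolding num_messages_def by simp
  show "2 powr (real n * R) \<le> num_messages n R" unfolding num_messages_def
    by (rule real_nat_ceiling_ge)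
qed

lemma sum_fst: "(\<Sum>i\<in>A \<times> B. f (fst i)) = card B * (\<Sum>a\<in>A. f a :: real)"
  by (simp add: sum.cartesian_product' sum_distrib_left)

lemma log_bound:
  fixes p :: "nat \<Rightarrow> real"
  assumes "finite A"
  obtains c where "c > 0" "\<And>i. i \<in> A \<Longrightarrow> 1 + \<bar>log 2 (p i)\<bar> \<le> c"
proof
  show "1 + (\<Sum>i\<in>A. \<bar>log 2 (p i)\<bar>) > 0" by (intro add_pos_nonneg sum_nonneg) auto
  show "1 + \<bar>log 2 (p i)\<bar> \<le> 1 + (\<Sum>i\<in>A. \<bar>log 2 (p i)\<bar>)" if "i \<in> A" for i
    using member_le_sum[of i A "\<lambda>i. \<bar>log 2 (p i)\<bar>"] that assms by auto
qed

lemma exp_decay: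
  fixes a :: real
  assumes "a > 0"
  shows "(\<lambda>n. exp (- a * real n)) \<longlonglongrightarrow> 0"
proof -
  have "(\<lambda>n. exp (- a) ^ n) \<longlonglongrightarrow> 0" using assms by (intro LIMSEQ_realpow_zero) auto
  then show ?thesis by (simp add: exp_of_nat_mult[symmetric] mult.commute)
qed

lemma powr_decay:
  fixes a :: real
  assumes "a > 0"
  shows "(\<lambda>n. 2 powr (- a * real n)) \<longlonglongrightarrow> 0"
  using exp_decay[of "a * ln 2"] assms by (simp add: powr_def mult_ac)

section \<open>Converse for a single hop\<close>

lemma strong_converse:
  fixes p :: "nat \<Rightarrow> real"
  assumes K: "K \<ge> 1" and p: "\<forall>i\<in>{1..K}. p i \<in> {0..1/2}"
    and R: "0 \<le> R" "(\<Sum>i=1..K. bsc_cap (p i)) < R"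
  shows "\<forall>\<^sub>F n in sequentially. \<forall>x g. (\<forall>w. x w \<in> cube ({1..K} \<times> {1..n})) \<longrightarrow>
    (\<Sum>w<num_messages n R. measure_pmf.prob (noise_pmf K n p) {e. g (vxor (x w) e) = w}) / num_messages n R \<le> 1 / 2"
proof -
  obtain c where c: "c > 0" "\<And>i. i \<in> {1..K} \<Longrightarrow> 1 + \<bar>log 2 (p i)\<bar> \<le> c"
    using log_bound[of "{1..K}" p] by auto
  define C where "C = (\<Sum>i=1..K. bsc_cap (p i))"
  \<comment> \<open>Half of the gap \<open>R - C\<close> pays for the deviation of the
    self-information; the other half remains as the exponent \<open>\<gamma>\<close>.\<close>
  define \<delta> where "\<delta> = (R - C) / (2 * K)"
  have \<delta>: "\<delta> > 0" using R K by (simp add: \<delta>_def C_def)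
  define \<alpha> where "\<alpha> = 2 * \<delta>\<^sup>2 / c\<^sup>2 * K"
  define \<gamma> where "\<gamma> = (R - C) / 2"
  have \<alpha>: "\<alpha> > 0" using \<delta> c K by (simp add: \<alpha>_def)
  have \<gamma>: "\<gamma> > 0" using R by (simp add: \<gamma>_def C_def)
  have "(\<lambda>n. exp (- \<alpha> * real n) + 2 powr (- \<gamma> * real n)) \<longlonglongrightarrow> 0 + 0"
    using \<alpha> \<gamma> by (intro tendsto_add exp_decay powr_decay)
  then have "\<forall>\<^sub>F n in sequentially. exp (- \<alpha> * real n) + 2 powr (- \<gamma> * real n) < 1 / 2"
    by (rule order_tendstoD) simp
  then show ?thesis
    using eventually_ge_at_top[of 1]
  proof eventually_elim
    case (elim n)
    show ?case
    proof (intro allI impI)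
      fix x :: "nat \<Rightarrow> nat \<times> nat \<Rightarrow> bool" and g
      assume x: "\<forall>w. x w \<in> cube ({1..K} \<times> {1..n})"
      let ?I = "{1..K} \<times> {1..n}" and ?M = "num_messages n R"
      let ?a = "(\<Sum>i\<in>?I. binent ((p \<circ> fst) i)) - \<delta> * real (card ?I)"
      interpret noise_concentration ?I "p \<circ> fst" "p \<circ> fst" c
        using K elim p c by unfold_locales auto
      have M: "2 powr (real n * R) \<le> ?M" "?M > 0" using num_messages_bounds[OF R(1)] by auto
      have rate: "card ?I - ?a - n * R = - \<gamma> * n"
        using K by (simp add: sum_fst[of "\<lambda>i. binent (p i)"] \<gamma>_def \<delta>_def C_def bsc_cap_def sum_subtractf field_simps)
      have "(\<Sum>w<?M. measure_pmf.prob (noise_pmf K n p) {e. g (vxor (x w) e) = w}) / ?M \<le>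
          measure_pmf.prob (bsc_noise ?I (p \<circ> fst)) {e. (\<Sum>i\<in>?I. self_info ((p \<circ> fst) i) (e i)) < ?a}
          + 2 powr (card ?I - ?a) / ?M"
        unfolding noise_pmf_eq using p x M by (intro additive_converse) auto
      also have "\<dots> \<le> exp (- (2 * \<delta>\<^sup>2 / c\<^sup>2) * real (card ?I)) + 2 powr (card ?I - ?a) / 2 powr (real n * R)"
        using M by (intro add_mono self_info_lower_tail \<delta> divide_left_mono) auto
      also have "\<dots> = exp (- \<alpha> * n) + 2 powr (- \<gamma> * n)"
        unfolding powr_diff[symmetric] rate by (simp add: \<alpha>_def)
      finally show "(\<Sum>w<?M. measure_pmf.prob (noise_pmf K n p) {e. g (vxor (x w) e) = w}) / ?M \<le> 1 / 2"
        using elim by linarith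
    qed
  qed
qed

text \<open>For fixed \<open>z\<close> the relay transmissions form a codeword for the
  \<open>K\<close> parallel links that does not depend on \<open>e\<close>, since there is no
  feedback.\<close>

lemma decoded_dest:
  "decoded K n c w z e =
    (\<lambda>y. dec c (map (\<lambda>i. map (\<lambda>t. y (i, t)) [1..<Suc n]) [1..<Suc K]))
      (vxor (\<lambda>(i, t). (i, t) \<in> {1..K} \<times> {1..n} \<and> relay_out c w z i t) e)"
  by (auto simp: decoded_def dest_in_def vxor_def intro!: arg_cong[where f = "dec c"])

text \<open>For fixed \<open>e\<close> the relays and the destination act as one decoder for the
  source word, sent over all \<open>K\<close> first-hop links in parallel. This yields the sum of
  the first-hop capacities as a bound, a single term for \<open>K = 1\<close>.\<close>

lemma decoded_relay:
  "decoded K n c w z e =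
    (\<lambda>v. dec c (map (\<lambda>i. map (\<lambda>t. rel c i (map (\<lambda>s. v (i, s)) [1..<t]) \<noteq> e (i, t)) [1..<Suc n]) [1..<Suc K]))
      (vxor (\<lambda>(i, t). (i, t) \<in> {1..K} \<times> {1..n} \<and> src c w t) z)"
proof -
  \<comment> \<open>A relay reads only slots \<open>s < t \<le> n\<close>, where cutting the source
    word down to the cube changes nothing.\<close>
  have "relay_out c w z i t =
      rel c i (map (\<lambda>s. vxor (\<lambda>(i, t). (i, t) \<in> {1..K} \<times> {1..n} \<and> src c w t) z (i, s)) [1..<t])"
    if "i \<in> {1..K}" "t \<le> n" for i t
    unfolding relay_out_def using that
    by (intro arg_cong[where f = "rel c i"]) (auto simp: relay_in_def vxor_def)
  then show ?thesis
    by (auto simp: decoded_def dest_in_def intro!: arg_cong[where f = "dec c"])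
qed

lemma achievable_le_dest:
  assumes "K \<ge> 1" "\<forall>i\<in>{1..K}. pd i \<in> {0..1/2}" "achievable K ps pd R"
  shows "R \<le> (\<Sum>i=1..K. bsc_cap (pd i))"
proof (rule ccontr)
  assume "\<not> ?thesis"
  then have R: "0 \<le> R" "(\<Sum>i=1..K. bsc_cap (pd i)) < R" using assms(3) by (auto simp: achievable_def)
  from assms(3) have "\<forall>\<^sub>F n in sequentially. \<exists>c. error_prob K ps pd (num_messages n R) n c < 1 / 2"
    unfolding achievable_def by (auto dest: spec[of _ "1/2"])
  with strong_converse[where p = pd and K = K and R = R, OF assms(1,2) R] have "\<forall>\<^sub>F n in sequentially. False"
  proof eventually_elim
    case (elim n)
    then obtain c where c: "error_prob K ps pd (num_messages n R) n c < 1 / 2" by blast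
    have "1 - error_prob K ps pd (num_messages n R) n c \<le> 1 / 2"
      unfolding decoded_dest using num_messages_bounds[OF R(1)]
      by (intro success_prob_le_dest, simp, unfold decoded_dest, intro elim(1)[rule_format]) (auto simp: cube_iff)
    with c show False by linarith
  qed
  then show False by simp
qed

lemma achievable_le_relay:
  assumes "K \<ge> 1" "\<forall>i\<in>{1..K}. ps i \<in> {0..1/2}" "achievable K ps pd R"
  shows "R \<le> (\<Sum>i=1..K. bsc_cap (ps i))"
proof (rule ccontr)
  assume "\<not> ?thesis"
  then have R: "0 \<le> R" "(\<Sum>i=1..K. bsc_cap (ps i)) < R" using assms(3) by (auto simp: achievable_def)
  from assms(3) have "\<forall>\<^sub>F n in sequentially. \<exists>c. error_prob K ps pd (num_messages n R) n c < 1 / 2"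
    unfolding achievable_def by (auto dest: spec[of _ "1/2"])
  with strong_converse[where p = ps and K = K and R = R, OF assms(1,2) R] have "\<forall>\<^sub>F n in sequentially. False"
  proof eventually_elim
    case (elim n)
    then obtain c where c: "error_prob K ps pd (num_messages n R) n c < 1 / 2" by blast
    have "1 - error_prob K ps pd (num_messages n R) n c \<le> 1 / 2"
      using num_messages_bounds[OF R(1)]
      by (intro success_prob_le_relay, simp, unfold decoded_relay, intro elim(1)[rule_format]) (auto simp: cube_iff)
    with c show False by linarith
  qed
  then show False by simp
qed

section \<open>Achievability by block Markov coding\<close>

text \<open>\<open>J\<close> ranges over all slot sets of size \<open>m\<close>, so one threshold
  serves every block. Half of the gap \<open>C - R\<close> is spent on \<open>\<delta>\<close>, and
  the other half leaves the decay rate \<open>\<gamma>\<close>.\<close>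

lemma eventually_channel_code:
  fixes q :: "nat \<Rightarrow> real" and p :: "'k \<Rightarrow> nat \<Rightarrow> real"
  assumes S: "finite S" "S \<noteq> {}" and F: "finite F"
    and p: "\<And>k s. k \<in> F \<Longrightarrow> s \<in> S \<Longrightarrow> 0 \<le> p k s" "\<And>k s. k \<in> F \<Longrightarrow> s \<in> S \<Longrightarrow> p k s \<le> q s"
    and q: "\<And>s. s \<in> S \<Longrightarrow> 0 \<le> q s" "\<And>s. s \<in> S \<Longrightarrow> q s \<le> 1/2"
    and R: "0 \<le> R" "R < (\<Sum>s\<in>S. bsc_cap (q s))" and \<eta>: "\<eta> > 0"
  shows "\<forall>\<^sub>F m in sequentially. \<forall>J :: nat set. finite J \<longrightarrow> card J = m \<longrightarrow>
    (\<exists>x d. \<forall>w<num_messages m R. x w \<in> cube (S \<times> J) \<and>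
      (\<forall>k\<in>F. measure_pmf.prob (bsc_noise (S \<times> J) (p k \<circ> fst)) {e. d (vxor (x w) e) \<noteq> w} \<le> \<eta>))"
proof -
  obtain c where c: "c > 0" "\<And>i. i \<in> S \<Longrightarrow> 1 + \<bar>log 2 (q i)\<bar> \<le> c"
    using log_bound[of S q] S by auto
  define C where "C = (\<Sum>s\<in>S. bsc_cap (q s))"
  have S_pos: "real (card S) > 0" using S by (simp add: card_gt_0_iff)
  define \<delta> where "\<delta> = (C - R) / (2 * card S)"
  have \<delta>: "\<delta> > 0" using R S_pos unfolding \<delta>_def C_def by (intro divide_pos_pos) auto
  define \<alpha> where "\<alpha> = 2 * \<delta>\<^sup>2 / c\<^sup>2 * card S"
  define \<gamma> where "\<gamma> = (C - R) / 2"
  have \<alpha>: "\<alpha> > 0" using \<delta> c S_pos by (simp add: \<alpha>_def)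
  have \<gamma>: "\<gamma> > 0" using R by (simp add: \<gamma>_def C_def)
  have "(\<lambda>n. exp (- \<alpha> * real n) + 2 * card F * 2 powr (- \<gamma> * real n)) \<longlonglongrightarrow> 0 + real (2 * card F) * 0"
    using \<alpha> \<gamma> by (intro tendsto_intros exp_decay powr_decay)
  then have "\<forall>\<^sub>F n in sequentially. exp (- \<alpha> * real n) + 2 * card F * 2 powr (- \<gamma> * real n) < \<eta>"
    by (rule order_tendstoD) (use \<eta> in simp)
  then show ?thesis
    using eventually_ge_at_top[of 1]
  proof eventually_elim
    case (elim m)
    show ?case
    proof (intro allI impI)
      fix J :: "nat set" assume J: "finite J" "card J = m"
      let ?I = "S \<times> J" and ?M = "num_messages m R"
      have I: "finite ?I" "?I \<noteq> {}" using S J elim by auto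
      \<comment> \<open>Rounding up adds at most 1, so it costs at most a factor 2.\<close>
      have "2 powr (m * R) \<ge> 1" using R by (intro ge_one_powr_ge_zero) auto
      then have M: "real ?M \<le> 2 * 2 powr (m * R)"
        unfolding num_messages_def by linarith
      have rate: "\<delta> * real (card ?I) - (\<Sum>i\<in>?I. bsc_cap ((q \<circ> fst) i)) + m * R = - \<gamma> * m"
        using S_pos J by (simp add: sum_fst[of "\<lambda>s. bsc_cap (q s)"] card_cartesian_product \<delta>_def \<gamma>_def
          C_def field_simps)
      let ?bound = "exp (- (2 * \<delta>\<^sup>2 / c\<^sup>2) * real (card ?I))
        + card F * ?M * 2 powr (\<delta> * real (card ?I) - (\<Sum>i\<in>?I. bsc_cap ((q \<circ> fst) i)))"
      have "\<exists>x d. \<forall>w<?M. x w \<in> cube ?I \<and>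
          (\<forall>k\<in>F. measure_pmf.prob (bsc_noise ?I (p k \<circ> fst)) {e. d (vxor (x w) e) \<noteq> w} \<le> ?bound)"
        using I F p q c \<delta> by (intro channel_code) auto
      then obtain x d where xd: "\<And>w. w < ?M \<Longrightarrow> x w \<in> cube ?I"
        "\<And>w k. w < ?M \<Longrightarrow> k \<in> F \<Longrightarrow>
          measure_pmf.prob (bsc_noise ?I (p k \<circ> fst)) {e. d (vxor (x w) e) \<noteq> w} \<le> ?bound"
        by blast
      have "card F * real ?M * 2 powr (\<delta> * real (card ?I) - (\<Sum>i\<in>?I. bsc_cap ((q \<circ> fst) i)))
          \<le> card F * (2 * 2 powr (m * R)) * 2 powr (\<delta> * real (card ?I) - (\<Sum>i\<in>?I. bsc_cap ((q \<circ> fst) i)))"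
        using M by (intro mult_right_mono mult_left_mono) auto
      also have "\<dots> = 2 * card F * 2 powr (- \<gamma> * m)"
        unfolding rate[symmetric] powr_add by simp
      moreover have "exp (- (2 * \<delta>\<^sup>2 / c\<^sup>2) * real (card ?I)) = exp (- \<alpha> * m)"
        using J by (simp add: \<alpha>_def card_cartesian_product)
      ultimately have "measure_pmf.prob (bsc_noise ?I (p k \<circ> fst)) {e. d (vxor (x w) e) \<noteq> w} \<le> \<eta>"
        if "w < ?M" "k \<in> F" for w k
        using xd(2)[OF that] elim by (simp only: of_nat_mult)
      with xd(1) show "\<exists>x d. \<forall>w<?M. x w \<in> cube ?I \<and>
          (\<forall>k\<in>F. measure_pmf.prob (bsc_noise ?I (p k \<circ> fst)) {e. d (vxor (x w) e) \<noteq> w} \<le> \<eta>)"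
        by blast
    qed
  qed
qed

section \<open>The block Markov scheme\<close>

text \<open>Blocks are numbered from 0 but slots from 1, which explains the shifts by one
  below.\<close>

definition block :: "nat \<Rightarrow> nat \<Rightarrow> nat set" where
  "block m b = {b * m + 1..b * m + m}"

lemma finite_block [simp]: "finite (block m b)"
  by (simp add: block_def)

lemma card_block [simp]: "card (block m b) = m"
  by (simp add: block_def)

lemma block_div: "t \<in> block m b \<Longrightarrow> (t - 1) div m = b"
  unfolding block_def by (intro div_nat_eqI) (auto simp: mult.commute)

lemma block_pos: "t \<in> block m b \<Longrightarrow> 1 \<le> t"
  by (auto simp: block_def)

lemma block_less: "s \<in> block m b \<Longrightarrow> t \<in> block m (Suc b) \<Longrightarrow> s < t"
  by (auto simp: block_def)

lemma block_le:
  assumes "t \<in> block m b" "b \<le> B" "(B + 1) * m \<le> n"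
  shows "t \<le> n"
proof -
  have "(b + 1) * m \<le> (B + 1) * m" using assms(2) by (intro mult_right_mono) auto
  moreover have "t \<le> (b + 1) * m" using assms(1) by (simp add: block_def)
  ultimately show ?thesis using assms(3) by linarith
qed

text \<open>
  The source code lives on \<open>{0} \<times> block m b\<close> so that both hops use index pairs. The message \<open>w\<close> is
  split into the sub-messages \<open>f w b\<close>; the source sends \<open>f w b\<close> in block \<open>b\<close> and the relays
  forward it in block \<open>Suc b\<close>.
\<close>

locale block_markov =
  fixes K n m B M M' :: nat and ps pd :: "nat \<Rightarrow> real"
    and xs xd :: "nat \<Rightarrow> nat \<Rightarrow> nat \<times> nat \<Rightarrow> bool" and ds dd :: "nat \<Rightarrow> (nat \<times> nat \<Rightarrow> bool) \<Rightarrow> nat"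
    and f :: "nat \<Rightarrow> nat \<Rightarrow> nat" and \<eta> :: real
  assumes M: "M > 0" and n: "(B + 1) * m \<le> n"
    and f: "inj_on f {..<M}" "f \<in> {..<M} \<rightarrow> ({..<B} \<rightarrow>\<^sub>E {..<M'})"
    and xs: "\<And>b w. b < B \<Longrightarrow> w < M' \<Longrightarrow> xs b w \<in> cube ({0} \<times> block m b)"
    and ds: "\<And>b w i. b < B \<Longrightarrow> w < M' \<Longrightarrow> i \<in> {1..K} \<Longrightarrow>
      measure_pmf.prob (bsc_noise ({0} \<times> block m b) (\<lambda>_. ps i)) {e. ds b (vxor (xs b w) e) \<noteq> w} \<le> \<eta>"
    and xd: "\<And>b w. b < B \<Longrightarrow> w < M' \<Longrightarrow> xd b w \<in> cube ({1..K} \<times> block m (Suc b))"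
    and dd: "\<And>b w. b < B \<Longrightarrow> w < M' \<Longrightarrow>
      measure_pmf.prob (bsc_noise ({1..K} \<times> block m (Suc b)) (pd \<circ> fst)) {e. dd b (vxor (xd b w) e) \<noteq> w} \<le> \<eta>"
begin

definition relay_block :: "nat \<Rightarrow> bool list \<Rightarrow> nat \<times> nat \<Rightarrow> bool" where
  "relay_block b past = (\<lambda>y. if y \<in> {0} \<times> block m b then past ! (snd y - 1) else False)"

definition dest_block :: "nat \<Rightarrow> bool list list \<Rightarrow> nat \<times> nat \<Rightarrow> bool" where
  "dest_block b ys = (\<lambda>y. if y \<in> {1..K} \<times> block m (Suc b) then ys ! (fst y - 1) ! (snd y - 1) else False)"

text \<open>In slot \<open>t\<close> a relay knows \<open>t - 1\<close> symbols, so
  \<open>length past div m\<close> is the current block. In block 0 it has decoded nothing and sends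
  \<open>False\<close>; in each of the next \<open>B\<close> blocks it forwards its row of the
  codeword for its own estimate of the preceding sub-message.\<close>

definition code :: bspr_code where
  "code = \<lparr>src = (\<lambda>w t. let b = (t - 1) div m in b < B \<and> xs b (f w b) (0, t)),
    rel = (\<lambda>i past. case length past div m of 0 \<Rightarrow> False
      | Suc b \<Rightarrow> b < B \<and> xd b (ds b (relay_block b past)) (i, Suc (length past))),
    dec = (\<lambda>ys. inv_into {..<M} f (\<lambda>b\<in>{..<B}. dd b (dest_block b ys)))\<rparr>"

text \<open>The event refers to the true sub-message and to the noise of one block, not to what
  happens in other blocks. Likewise \<open>dest_ok\<close> presupposes that the correct joint
  codeword is sent.\<close>

definition relay_ok :: "nat \<Rightarrow> (nat \<times> nat \<Rightarrow> bool) \<Rightarrow> nat \<Rightarrow> nat \<Rightarrow> bool" where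
  "relay_ok w z i b \<longleftrightarrow>
    ds b (vxor (xs b (f w b)) (\<lambda>y. if y \<in> {0} \<times> block m b then z (i, snd y) else False)) = f w b"

definition dest_ok :: "nat \<Rightarrow> (nat \<times> nat \<Rightarrow> bool) \<Rightarrow> nat \<Rightarrow> bool" where
  "dest_ok w e b \<longleftrightarrow>
    dd b (vxor (xd b (f w b)) (\<lambda>y. if y \<in> {1..K} \<times> block m (Suc b) then e y else False)) = f w b"

lemma f_less: "w < M \<Longrightarrow> b < B \<Longrightarrow> f w b < M'"
  using f(2) by (fastforce simp: Pi_iff PiE_iff)

text \<open>Causality: block \<open>b\<close> is complete before any slot of block
  \<open>Suc b\<close>, and during it the relay sees the source codeword plus its noise.\<close>

lemma relay_out_code:
  assumes w: "w < M" and b: "b < B" and ok: "relay_ok w z i b" and t: "t \<in> block m (Suc b)"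
  shows "relay_out code w z i t = xd b (f w b) (i, t)"
proof -
  let ?past = "map (relay_in code w z i) [1..<t]"
  have "relay_block b ?past = vxor (xs b (f w b)) (\<lambda>y. if y \<in> {0} \<times> block m b then z (i, snd y) else False)"
  proof
    fix y :: "nat \<times> nat"
    show "relay_block b ?past y =
        vxor (xs b (f w b)) (\<lambda>y. if y \<in> {0} \<times> block m b then z (i, snd y) else False) y"
    proof (cases "y \<in> {0} \<times> block m b")
      case True
      then obtain s where y: "y = (0, s)" and s: "s \<in> block m b" by auto
      have "s - 1 < length [1..<t]" using block_pos[OF s] block_less[OF s t] by simp
      then have "?past ! (s - 1) = relay_in code w z i s"
        using block_pos[OF s] by (simp add: nth_upt)
      also have "\<dots> = (xs b (f w b) (0, s) \<noteq> z (i, s))"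
        unfolding relay_in_def code_def Let_def bspr_code.simps block_div[OF s] using b by simp
      finally show ?thesis using y s by (simp add: relay_block_def vxor_def)
    next
      case False
      then have "\<not> xs b (f w b) y"
        using xs[OF b f_less[OF w b]] unfolding cube_iff by blast
      with False show ?thesis by (simp add: relay_block_def vxor_def)
    qed
  qed
  then have "ds b (relay_block b ?past) = f w b"
    using ok by (simp add: relay_ok_def)
  moreover have "length ?past = t - 1" by simp
  moreover have "Suc (t - 1) = t" using block_pos[OF t] by simp
  ultimately show ?thesis
    using b block_div[OF t] by (simp add: relay_out_def code_def)
qed

text \<open>When all relays succeed, their transmissions in block \<open>Suc b\<close> are together
  the codeword of \<open>f w b\<close>, so the destination faces the parallel channel code.
  Injectivity of \<open>f\<close> recovers \<open>w\<close> from the sub-messages.\<close>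

lemma decoded_code:
  assumes w: "w < M" and relay: "\<And>i b. i \<in> {1..K} \<Longrightarrow> b < B \<Longrightarrow> relay_ok w z i b"
    and dest: "\<And>b. b < B \<Longrightarrow> dest_ok w e b"
  shows "decoded K n code w z e = w"
proof -
  let ?ys = "map (\<lambda>i. map (dest_in code w z e i) [1..<Suc n]) [1..<Suc K]"
  have "dd b (dest_block b ?ys) = f w b" if b: "b < B" for b
  proof -
    have "dest_block b ?ys =
        vxor (xd b (f w b)) (\<lambda>y. if y \<in> {1..K} \<times> block m (Suc b) then e y else False)"
    proof
      fix y :: "nat \<times> nat"
      show "dest_block b ?ys y =
          vxor (xd b (f w b)) (\<lambda>y. if y \<in> {1..K} \<times> block m (Suc b) then e y else False) y"
      proof (cases "y \<in> {1..K} \<times> block m (Suc b)")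
        case True
        then obtain i t where y: "y = (i, t)" and i: "i \<in> {1..K}" and t: "t \<in> block m (Suc b)" by auto
        have "t \<le> n" using block_le[OF t _ n] b by simp
        moreover have "1 \<le> i" "i \<le> K" using i by auto
        moreover from this have "[1..<Suc K] ! (i - 1) = i" by (subst nth_upt) auto
        moreover have "[1..<Suc n] ! (t - 1) = t"
          using \<open>t \<le> n\<close> block_pos[OF t] by (subst nth_upt) auto
        ultimately have "?ys ! (i - 1) ! (t - 1) = dest_in code w z e i t"
          using block_pos[OF t] by (simp del: upt_Suc)
        then show ?thesis
          using True relay_out_code[OF w b relay[OF i b] t]
          by (simp add: y dest_block_def vxor_def dest_in_def)
      next
        case False
        then have "\<not> xd b (f w b) y"
          using xd[OF b f_less[OF w b]] unfolding cube_iff by blast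
        with False show ?thesis by (simp add: dest_block_def vxor_def)
      qed
    qed
    then show ?thesis using dest[OF b] by (simp add: dest_ok_def)
  qed
  then have "(\<lambda>b\<in>{..<B}. dd b (dest_block b ?ys)) = (\<lambda>b\<in>{..<B}. f w b)"
    by (auto simp: restrict_def)
  also have "\<dots> = f w"
    using f(2) w by (intro PiE_restrict) auto
  finally show ?thesis
    using f(1) w by (simp add: decoded_def code_def)
qed

text \<open>The noise of relay \<open>i\<close> in block \<open>b\<close>, relabelled by
  \<open>map_bsc_noise\<close> with \<open>(0, t)\<close> sent to \<open>(i, t)\<close>, has the law
  that the block code is built for.\<close>

lemma prob_not_relay_ok:
  assumes w: "w < M" and b: "b < B" and i: "i \<in> {1..K}"
  shows "measure_pmf.prob (noise_pmf K n ps) {z. \<not> relay_ok w z i b} \<le> \<eta>"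
proof -
  let ?r = "\<lambda>z y. if y \<in> {0} \<times> block m b then z (i, snd y) else False"
  have "t \<in> {1..n}" if "t \<in> block m b" for t
    using that block_pos[OF that] block_le[OF that _ n] b by simp
  then have noise: "map_pmf ?r (noise_pmf K n ps) = bsc_noise ({0} \<times> block m b) (\<lambda>_. ps i)"
    unfolding noise_pmf_eq using i
    by (subst map_bsc_noise) (auto simp: inj_on_def o_def)
  have "{z. \<not> relay_ok w z i b} = ?r -` {e. ds b (vxor (xs b (f w b)) e) \<noteq> f w b}"
    unfolding relay_ok_def vimage_def by simp
  then have "measure_pmf.prob (noise_pmf K n ps) {z. \<not> relay_ok w z i b} =
      measure_pmf.prob (bsc_noise ({0} \<times> block m b) (\<lambda>_. ps i)) {e. ds b (vxor (xs b (f w b)) e) \<noteq> f w b}"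
    unfolding noise[symmetric] measure_map_pmf by simp
  then show ?thesis using ds[OF b f_less[OF w b] i] by simp
qed

lemma prob_not_dest_ok:
  assumes w: "w < M" and b: "b < B"
  shows "measure_pmf.prob (noise_pmf K n pd) {e. \<not> dest_ok w e b} \<le> \<eta>"
proof -
  let ?r = "\<lambda>e y. if y \<in> {1..K} \<times> block m (Suc b) then e (id y) else False"
  have "t \<in> {1..n}" if "t \<in> block m (Suc b)" for t
    using that block_pos[OF that] block_le[OF that _ n] b by simp
  then have noise: "map_pmf ?r (noise_pmf K n pd) = bsc_noise ({1..K} \<times> block m (Suc b)) (pd \<circ> fst)"
    unfolding noise_pmf_eq
    by (subst map_bsc_noise) auto
  have "{e. \<not> dest_ok w e b} = ?r -` {e. dd b (vxor (xd b (f w b)) e) \<noteq> f w b}"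
    unfolding dest_ok_def vimage_def by simp
  then have "measure_pmf.prob (noise_pmf K n pd) {e. \<not> dest_ok w e b} =
      measure_pmf.prob (bsc_noise ({1..K} \<times> block m (Suc b)) (pd \<circ> fst)) {e. dd b (vxor (xd b (f w b)) e) \<noteq> f w b}"
    unfolding noise[symmetric] measure_map_pmf by simp
  then show ?thesis using dd[OF b f_less[OF w b]] by simp
qed

text \<open>Union bound over \<open>K\<close> relays and the destination in each of \<open>B\<close>
  blocks. It holds for every message, hence for the average.\<close>

lemma error_prob_code: "error_prob K ps pd M n code \<le> B * (K + 1) * \<eta>"
proof -
  let ?D = "pair_pmf (noise_pmf K n ps) (noise_pmf K n pd)"
  have err: "measure_pmf.prob ?D {(z, e). decoded K n code w z e \<noteq> w} \<le> B * (K + 1) * \<eta>" if w: "w < M" for w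
  proof -
    let ?Z = "\<Union>(i, b)\<in>{1..K} \<times> {..<B}. {z. \<not> relay_ok w z i b}" and ?E = "\<Union>b\<in>{..<B}. {e. \<not> dest_ok w e b}"
    have "measure_pmf.prob ?D {(z, e). decoded K n code w z e \<noteq> w}
        \<le> measure_pmf.prob ?D (fst -` ?Z \<union> snd -` ?E)"
    proof (intro measure_pmf.finite_measure_mono subsetI)
      fix ze assume "ze \<in> {(z, e). decoded K n code w z e \<noteq> w}"
      then obtain z e where ze: "ze = (z, e)" "decoded K n code w z e \<noteq> w" by auto
      then have "(\<exists>i\<in>{1..K}. \<exists>b<B. \<not> relay_ok w z i b) \<or> (\<exists>b<B. \<not> dest_ok w e b)"
        using decoded_code[OF w, of z e] by blast
      with ze(1) show "ze \<in> fst -` ?Z \<union> snd -` ?E" by auto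
    qed simp
    also have "\<dots> \<le> measure_pmf.prob ?D (fst -` ?Z) + measure_pmf.prob ?D (snd -` ?E)"
      by (rule measure_Un_le) auto
    also have "measure_pmf.prob ?D (fst -` ?Z) = measure_pmf.prob (noise_pmf K n ps) ?Z"
      by (subst measure_map_pmf[symmetric]) (simp add: map_fst_pair_pmf)
    also have "measure_pmf.prob ?D (snd -` ?E) = measure_pmf.prob (noise_pmf K n pd) ?E"
      by (subst measure_map_pmf[symmetric]) (simp add: map_snd_pair_pmf)
    also have "measure_pmf.prob (noise_pmf K n ps) ?Z \<le>
        (\<Sum>(i, b)\<in>{1..K} \<times> {..<B}. measure_pmf.prob (noise_pmf K n ps) {z. \<not> relay_ok w z i b})"
      unfolding case_prod_unfold by (intro measure_UNION_le) auto
    also have "\<dots> \<le> (\<Sum>(i, b)\<in>{1..K} \<times> {..<B}. \<eta>)"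
      using prob_not_relay_ok[OF w] by (intro sum_mono) auto
    also have "measure_pmf.prob (noise_pmf K n pd) ?E \<le>
        (\<Sum>b\<in>{..<B}. measure_pmf.prob (noise_pmf K n pd) {e. \<not> dest_ok w e b})"
      by (intro measure_UNION_le) auto
    also have "\<dots> \<le> (\<Sum>b\<in>{..<B}. \<eta>)"
      using prob_not_dest_ok[OF w] by (intro sum_mono) auto
    finally show ?thesis by (simp add: case_prod_unfold card_cartesian_product algebra_simps)
  qed
  have "error_prob K ps pd M n code = measure_pmf.prob (pair_pmf (pmf_of_set {0..<M}) ?D)
      {(w, ze). (\<lambda>(z, e). decoded K n code w z e \<noteq> w) ze}"
    unfolding error_prob_def by (intro arg_cong[where f = "measure_pmf.prob _"]) auto
  also have "\<dots> = measure_pmf.expectation (pmf_of_set {0..<M})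
      (\<lambda>w. measure_pmf.prob ?D {(z, e). decoded K n code w z e \<noteq> w})"
    unfolding prob_pair_pmf by simp
  also have "\<dots> \<le> B * (K + 1) * \<eta>"
    using M err by (intro measure_pmf.integral_le_const AE_pmfI) auto
  finally show ?thesis .
qed

end

section \<open>Achievable rates and the capacity\<close>

text \<open>A single message is decoded without error. This makes the set of achievable rates
  nonempty, so that its \<open>Sup\<close> is meaningful.\<close>

lemma achievable_zero: "achievable K ps pd 0"
proof -
  have "error_prob K ps pd (num_messages n 0) n \<lparr>src = undefined, rel = undefined, dec = \<lambda>_. 0\<rparr> = 0" for n
  proof -
    have "num_messages n 0 = 1" by (simp add: num_messages_def)
    then show ?thesis
      unfolding error_prob_def
      by (subst measure_pmf_zero_iff) (auto simp: decoded_def)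
  qed
  then show ?thesis
    unfolding achievable_def by (metis (mono_tags, lifting) always_eventually order_refl)
qed

text \<open>Each block carries a rate \<open>R'\<close> above \<open>R\<close>; \<open>B\<close>
  sub-messages take \<open>B + 1\<close> blocks because of the relay delay, and a large
  \<open>B\<close> makes this loss smaller than the gap.\<close>

lemma achievableI:
  fixes ps pd :: "nat \<Rightarrow> real"
  assumes K: "K \<ge> 1"
    and ps: "\<And>i. i \<in> {1..K} \<Longrightarrow> ps i \<in> {0..1/2}" and pd: "\<And>i. i \<in> {1..K} \<Longrightarrow> pd i \<in> {0..1/2}"
    and R: "0 \<le> R" "R < (\<Sum>i=1..K. bsc_cap (pd i))" "\<And>i. i \<in> {1..K} \<Longrightarrow> R < bsc_cap (ps i)"
  shows "achievable K ps pd R"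
proof -
  \<comment> \<open>The level of the noisiest relay is a majorant for all relays, and being attained
    it inherits the bound \<open>R < bsc_cap (ps i)\<close>.\<close>
  define pmax where "pmax = Max (ps ` {1..K})"
  have "pmax \<in> ps ` {1..K}" unfolding pmax_def using K by (intro Max_in) auto
  then obtain k where k: "k \<in> {1..K}" "pmax = ps k" by blast
  have pmax: "ps i \<le> pmax" if "i \<in> {1..K}" for i
    unfolding pmax_def using that by (intro Max_ge) auto
  obtain R' where R': "R < R'" "R' < min (\<Sum>i=1..K. bsc_cap (pd i)) (bsc_cap pmax)"
    using dense[of R "min (\<Sum>i=1..K. bsc_cap (pd i)) (bsc_cap pmax)"] R k by auto
  obtain B :: nat where "R / (R' - R) < B" using reals_Archimedean2 by blast
  then have B: "R * (B + 1) < R' * B" using R' by (simp add: field_simps)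
  show ?thesis
    unfolding achievable_def
  proof (intro conjI allI impI)
    fix \<epsilon> :: real assume \<epsilon>: "\<epsilon> > 0"
    define \<eta> where "\<eta> = \<epsilon> / (2 * (real B + 1) * (real K + 1))"
    have pos: "real B + 1 > 0" "real K + 1 > 0" by (auto intro: add_nonneg_pos)
    have \<eta>: "\<eta> > 0" unfolding \<eta>_def using \<epsilon> pos by (intro divide_pos_pos mult_pos_pos) simp_all
    have "B * (K + 1) * \<eta> \<le> (real B + 1) * (real K + 1) * \<eta>"
      using \<eta> by (intro mult_right_mono) (auto simp: algebra_simps)
    also have "\<dots> = \<epsilon> / 2"
    proof -
      have "x * y * (\<epsilon> / (2 * x * y)) = \<epsilon> / 2" if "x > 0" "y > 0" for x y :: real
        using that by simp
      from this[OF pos] show ?thesis unfolding \<eta>_def .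
    qed
    finally have small: "B * (K + 1) * \<eta> < \<epsilon>" using \<epsilon> by linarith
    have relay: "\<forall>\<^sub>F m in sequentially. \<forall>J :: nat set. finite J \<longrightarrow> card J = m \<longrightarrow>
      (\<exists>x d. \<forall>w<num_messages m R'. x w \<in> cube ({0::nat} \<times> J) \<and>
        (\<forall>i\<in>{1..K}. measure_pmf.prob (bsc_noise ({0::nat} \<times> J) ((\<lambda>_. ps i) \<circ> fst)) {e. d (vxor (x w) e) \<noteq> w} \<le> \<eta>))"
      using ps pmax k R R' \<eta> by (intro eventually_channel_code[where q = "\<lambda>_. pmax" and p = "\<lambda>i _. ps i"]) auto
    \<comment> \<open>Here there is a single noise law, indexed by \<open>()\<close>: the
      \<open>K\<close> links form one parallel channel that the destination decodes jointly.\<close>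
    have dest: "\<forall>\<^sub>F m in sequentially. \<forall>J :: nat set. finite J \<longrightarrow> card J = m \<longrightarrow>
      (\<exists>x d. \<forall>w<num_messages m R'. x w \<in> cube ({1..K} \<times> J) \<and>
        (\<forall>i\<in>{()}. measure_pmf.prob (bsc_noise ({1..K} \<times> J) (pd \<circ> fst)) {e. d (vxor (x w) e) \<noteq> w} \<le> \<eta>))"
      using pd K R R' \<eta> by (intro eventually_channel_code[where q = pd and p = "\<lambda>_. pd"]) auto
    have "\<forall>\<^sub>F m in sequentially. real m \<ge> (B + 1) * R / (R' * B - R * (B + 1))"
      by (rule eventually_compose_filterlim[OF eventually_ge_at_top filterlim_real_sequentially])
    with relay dest have "\<forall>\<^sub>F m in sequentially.
      (\<forall>J :: nat set. finite J \<longrightarrow> card J = m \<longrightarrow>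
        (\<exists>x d. \<forall>w<num_messages m R'. x w \<in> cube ({0::nat} \<times> J) \<and>
          (\<forall>i\<in>{1..K}. measure_pmf.prob (bsc_noise ({0::nat} \<times> J) ((\<lambda>_. ps i) \<circ> fst)) {e. d (vxor (x w) e) \<noteq> w} \<le> \<eta>))) \<and>
      (\<forall>J :: nat set. finite J \<longrightarrow> card J = m \<longrightarrow>
        (\<exists>x d. \<forall>w<num_messages m R'. x w \<in> cube ({1..K} \<times> J) \<and>
          (\<forall>i\<in>{()}. measure_pmf.prob (bsc_noise ({1..K} \<times> J) (pd \<circ> fst)) {e. d (vxor (x w) e) \<noteq> w} \<le> \<eta>))) \<and>
      real m \<ge> (B + 1) * R / (R' * B - R * (B + 1))" (is "eventually ?Q _")
      by eventually_elim blast
    then have "\<forall>\<^sub>F n in sequentially. ?Q (n div (B + 1))"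
      by (rule eventually_compose_filterlim[OF _ filterlim_at_top_div_const_nat]) simp
    then show "\<forall>\<^sub>F n in sequentially. \<exists>c. error_prob K ps pd (num_messages n R) n c < \<epsilon>"
    proof eventually_elim
      case (elim n)
      define m where "m = n div (B + 1)"
      let ?M = "num_messages n R" and ?M' = "num_messages m R'"
      note elim = elim[folded m_def]
      have R'_pos: "0 \<le> R'" using R R' by simp
      have "\<exists>x d. \<forall>w<?M'. x w \<in> cube ({0::nat} \<times> block m b) \<and>
          (\<forall>i\<in>{1..K}. measure_pmf.prob (bsc_noise ({0::nat} \<times> block m b) (\<lambda>_. ps i)) {e. d (vxor (x w) e) \<noteq> w} \<le> \<eta>)" for b
        using elim[THEN conjunct1, rule_format, of "block m b"] by (simp add: o_def)
      then obtain xs ds where relay_code: "\<And>b w. w < ?M' \<Longrightarrow> xs b w \<in> cube ({0::nat} \<times> block m b)"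
        "\<And>b w i. w < ?M' \<Longrightarrow> i \<in> {1..K} \<Longrightarrow>
          measure_pmf.prob (bsc_noise ({0::nat} \<times> block m b) (\<lambda>_. ps i)) {e. ds b (vxor (xs b w) e) \<noteq> w} \<le> \<eta>"
        by metis
      have "\<exists>x d. \<forall>w<?M'. x w \<in> cube ({1..K} \<times> block m (Suc b)) \<and>
          measure_pmf.prob (bsc_noise ({1..K} \<times> block m (Suc b)) (pd \<circ> fst)) {e. d (vxor (x w) e) \<noteq> w} \<le> \<eta>" for b
        using elim[THEN conjunct2, THEN conjunct1, rule_format, of "block m (Suc b)"] by simp
      then obtain xd dd where dest_code: "\<And>b w. w < ?M' \<Longrightarrow> xd b w \<in> cube ({1..K} \<times> block m (Suc b))"
        "\<And>b w. w < ?M' \<Longrightarrow>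
          measure_pmf.prob (bsc_noise ({1..K} \<times> block m (Suc b)) (pd \<circ> fst)) {e. dd b (vxor (xd b w) e) \<noteq> w} \<le> \<eta>"
        by metis
      have n: "(B + 1) * m \<le> n" by (simp only: m_def times_div_less_eq_dividend)
      have "n < (B + 1) * (m + 1)"
        unfolding m_def by (simp only: dividend_less_times_div zero_less_Suc
          add_Suc_right Suc_eq_plus1[symmetric] mult_Suc_right)
      then have "real n \<le> real ((B + 1) * (m + 1))" by (intro of_nat_mono) simp
      then have "n * R \<le> real ((B + 1) * (m + 1)) * R" using R by (intro mult_right_mono)
      \<comment> \<open>The lower bound on \<open>m\<close> absorbs the fewer than
        \<open>B + 1\<close> slots lost when \<open>n\<close> is rounded down to a multiple of
        \<open>B + 1\<close>.\<close>
      also have "(B + 1) * R \<le> m * (R' * B - R * (B + 1))"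
        using elim[THEN conjunct2, THEN conjunct2] B by (simp add: pos_divide_le_eq)
      then have "real ((B + 1) * (m + 1)) * R \<le> m * R' * B" by (simp add: algebra_simps)
      finally have rate: "n * R \<le> m * R' * B" .
      have "2 powr (n * R) \<le> 2 powr (m * R' * B)" using rate by simp
      also have "\<dots> = (2 powr (m * R')) ^ B" by (simp add: powr_powr[symmetric] powr_realpow)
      also have "\<dots> \<le> real ?M' ^ B" using num_messages_bounds(1)[OF R'_pos] by (intro power_mono) auto
      finally have "2 powr (n * R) \<le> real_of_int (int (?M' ^ B))" by simp
      then have "\<lceil>2 powr (n * R)\<rceil> \<le> int (?M' ^ B)" by (simp only: ceiling_le_iff)
      then have "?M \<le> ?M' ^ B" unfolding num_messages_def[of n] by linarith
      \<comment> \<open>Counting suffices to split messages: any injection into the tuples of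
        \<open>B\<close> sub-messages will do.\<close>
      then have "card {..<?M} \<le> card ({..<B} \<rightarrow>\<^sub>E {..<?M'})" by (simp add: card_PiE)
      then obtain f where f: "f ` {..<?M} \<subseteq> ({..<B} \<rightarrow>\<^sub>E {..<?M'})" "inj_on f {..<?M}"
        using card_le_inj[of "{..<?M}" "{..<B} \<rightarrow>\<^sub>E {..<?M'}"] by (auto intro: finite_PiE)
      interpret block_markov K n m B ?M ?M' ps pd xs xd ds dd f \<eta>
        using num_messages_bounds(2)[OF R(1)] n f relay_code dest_code by unfold_locales auto
      show ?case using error_prob_code small by (intro exI[of _ code]) linarith
    qed
  qed (rule R)
qed

lemma bsc_cap_nonneg: "p \<in> {0..1/2} \<Longrightarrow> 0 \<le> bsc_cap p"
  using binent_le_1[of p] by (simp add: bsc_cap_def)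

text \<open>Since rate 0 is achievable, the supremum is over a nonempty bounded set, and negative
  \<open>R\<close> in the density argument are harmless.\<close>

lemma capacity_eqI:
  assumes C: "0 \<le> C" and upper: "\<And>R. achievable K ps pd R \<Longrightarrow> R \<le> C"
    and lower: "\<And>R. 0 \<le> R \<Longrightarrow> R < C \<Longrightarrow> achievable K ps pd R"
  shows "capacity K ps pd = C"
  unfolding capacity_def
proof (rule antisym)
  show "Sup {R. achievable K ps pd R} \<le> C"
    using upper achievable_zero[of K ps pd] by (intro cSup_least) blast+
  have bdd: "bdd_above {R. achievable K ps pd R}" using upper by (auto simp: bdd_above_def)
  show "C \<le> Sup {R. achievable K ps pd R}"
  proof (rule dense_le)
    fix R assume "R < C"
    show "R \<le> Sup {R. achievable K ps pd R}"
    proof (cases "0 \<le> R")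
      case True
      then show ?thesis using lower \<open>R < C\<close> bdd by (intro cSup_upper) auto
    next
      case False
      have "0 \<le> Sup {R. achievable K ps pd R}" using achievable_zero bdd by (intro cSup_upper) auto
      with False show ?thesis by linarith
    qed
  qed
qed

theorem theorem7:
  fixes K :: nat and ps pd :: "nat \<Rightarrow> real"
  assumes "K \<ge> 1"
    and "\<And>i. i \<in> {1..K} \<Longrightarrow> ps i \<in> {0..1/2}"
    and "\<And>i. i \<in> {1..K} \<Longrightarrow> pd i \<in> {0..1/2}"
  shows "(K = 1 \<longrightarrow>
            capacity K ps pd =
              max_over (\<lambda>(q, r). min (bsc_info (ps 1) q) (bsc_info (pd 1) r))) \<and>
         (K > 1 \<and>
            (\<forall>i\<in>{1..K}. (\<Sum>j=1..K. max_over (bsc_info (pd j))) \<le> max_over (bsc_info (ps i))) \<longrightarrow>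
            capacity K ps pd = (\<Sum>i=1..K. max_over (bsc_info (pd i))))"
proof (intro conjI impI)
  note ps = assms(2) and pd = assms(3)
  have dest: "R \<le> (\<Sum>i=1..K. bsc_cap (pd i))" if "achievable K ps pd R" for R
    using achievable_le_dest assms that by blast
  have relay: "R \<le> (\<Sum>i=1..K. bsc_cap (ps i))" if "achievable K ps pd R" for R
    using achievable_le_relay assms that by blast
  {
    assume K: "K = 1"
    have "capacity K ps pd = min (bsc_cap (ps 1)) (bsc_cap (pd 1))"
    proof (rule capacity_eqI)
      show "0 \<le> min (bsc_cap (ps 1)) (bsc_cap (pd 1))"
        using bsc_cap_nonneg ps pd K by simp
      \<comment> \<open>For \<open>K = 1\<close> both sums have one term, and they bound the two
        hops separately.\<close>
      show "R \<le> min (bsc_cap (ps 1)) (bsc_cap (pd 1))" if "achievable K ps pd R" for R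
        using dest[OF that] relay[OF that] K by simp
      show "achievable K ps pd R" if "0 \<le> R" "R < min (bsc_cap (ps 1)) (bsc_cap (pd 1))" for R
        using that K ps pd by (intro achievableI) auto
    qed
    also have "\<dots> = max_over (\<lambda>(q, r). min (bsc_info (ps 1) q) (bsc_info (pd 1) r))"
      using ps[of 1] pd[of 1] K by (intro max_over_min_bsc_info[symmetric]) auto
    finally show "capacity K ps pd = max_over (\<lambda>(q, r). min (bsc_info (ps 1) q) (bsc_info (pd 1) r))" .
  next
    assume H: "K > 1 \<and>
      (\<forall>i\<in>{1..K}. (\<Sum>j=1..K. max_over (bsc_info (pd j))) \<le> max_over (bsc_info (ps i)))"
    have cap: "(\<Sum>j=1..K. max_over (bsc_info (pd j))) = (\<Sum>j=1..K. bsc_cap (pd j))"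
      using pd by (intro sum.cong max_over_bsc_info) fastforce+
    have "max_over (bsc_info (ps i)) = bsc_cap (ps i)" if "i \<in> {1..K}" for i
      using ps[OF that] by (intro max_over_bsc_info) auto
    \<comment> \<open>The hypothesis lets every single relay decode any rate below what the
      second-hop links carry jointly.\<close>
    with H cap have le: "(\<Sum>j=1..K. bsc_cap (pd j)) \<le> bsc_cap (ps i)" if "i \<in> {1..K}" for i
      using that by fastforce
    have "capacity K ps pd = (\<Sum>j=1..K. bsc_cap (pd j))"
    proof (rule capacity_eqI)
      show "0 \<le> (\<Sum>j=1..K. bsc_cap (pd j))"
        using bsc_cap_nonneg pd by (intro sum_nonneg) blast
      show "achievable K ps pd R" if "0 \<le> R" "R < (\<Sum>j=1..K. bsc_cap (pd j))" for R
        using that assms le by (intro achievableI) fastforce+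
    qed (rule dest)
    with cap show "capacity K ps pd = (\<Sum>i=1..K. max_over (bsc_info (pd i)))" by simp
  }
qed

end
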